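(* Let $\mathfrak{h}$ be a finite-dimensional complex vector space with a nondegenerate symmetric bilinear form and let $h,h'\in\mathfrak{h}$. The vertex operator algebras $(V_{\widehat{\mathfrak{h}}}(1,0),\omega_h)$ and $(V_{\widehat{\mathfrak{h}}}(1,0),\omega_{h'})$ are isomorphic if and only if $h'=g(h)$ for some $g\in\mathrm{O}(\mathfrak{h})$. In particular, the moduli space (set of isomorphism classes) of the conformal structures on $V_{\widehat{\mathfrak{h}}}(1,0)$ preserving the standard gradation is $\mathfrak{h}/\mathrm{O}(\mathfrak{h})$.
   Context: Everything is over $\mathbb{C}$. Put $d=\dim\mathfrak{h}$, with form $\langle\cdot,\cdot\rangle$; $\mathrm{O}(\mathfrak{h})$ is the group of linear automorphisms of $\mathfrak{h}$ preserving the form. $\widehat{\mathfrak{h}}=\mathbb{C}[t,t^{-1}]\otimes\mathfrak{h}\oplus\mathbb{C}C$ is the Lie algebra with $C$ central and $[u\otimes t^m,v\otimes t^n]=m\langle u,v\rangle\delta_{m,-n}C$. $V_{\widehat{\mathfrak{h}}}(1,0)=U(\widehat{\mathfrak{h}})\otimes_{U(\widehat{\mathfrak{h}}^{\geq 0})}\mathbb{C}\mathbf{1}$, where $\widehat{\mathfrak{h}}^{\ge 0}=\mathbb{C}[t]\otimes\mathfrak{h}\oplus\mathbb{C}C$ acts on $\mathbb{C}\mathbf{1}$ with $\mathbb{C}[t]\otimes\mathfrak{h}$ acting by $0$ and $C$ by $1$. Write $u(n)$ for the action of $u\otimes t^n$. It has a unique vertex algebra structure with vacuum $\mathbf{1}$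 and $Y(u(-1)\mathbf{1},z)=\sum_{n\in\mathbb{Z}}u(n)z^{-n-1}$. The standard gradation is $V_{\widehat{\mathfrak{h}}}(1,0)=\bigoplus_{n\ge0}V_{\widehat{\mathfrak{h}}}(1,0)_n$, where the degree-$n$ piece is spanned by the $u_1(-n_1)\cdots u_k(-n_k)\mathbf{1}$ with $k\ge 0$, $u_i\in\mathfrak{h}$, $n_i\ge1$, $\sum n_i=n$. For $h\in\mathfrak{h}$ and an orthonormal basis $h_1,\dots,h_d$, $\omega_h=\frac12\sum_{i=1}^d h_i(-1)^2\mathbf{1}+h(-2)\mathbf{1}$, a conformal vector. A conformal structure preserving the standard gradation is a conformal vector $\omega'$ (giving a vertex operator algebra structure on the vertex algebra $V_{\widehat{\mathfrak{h}}}(1,0)$) for which $L'(0)=\omega'_1$ acts on the degree-$n$ piece as multiplication by $n$ for all $n$. Isomorphisms of vertex operator algebras are isomorphisms of vertex algebras matching conformal vectors. *)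

theory Defs
  imports Complex_Main "HOL-Library.Poly_Mapping"
begin

section \<open>Complex vector spaces\<close>

class complex_vector = ab_group_add +
  fixes scaleC :: "complex \<Rightarrow> 'a \<Rightarrow> 'a"  (infixr \<open>*\<^sub>C\<close> 75)
  assumes scaleC_add_right: "a *\<^sub>C (x + y) = a *\<^sub>C x + a *\<^sub>C y"
    and scaleC_add_left: "(a + b) *\<^sub>C x = a *\<^sub>C x + b *\<^sub>C x"
    and scaleC_scaleC: "a *\<^sub>C b *\<^sub>C x = (a * b) *\<^sub>C x"
    and scaleC_one: "1 *\<^sub>C x = x"

global_interpretation complex_vector: vector_space "scaleC :: complex \<Rightarrow> 'a \<Rightarrow> 'a::complex_vector"
  by unfold_locales (simp_all add: scaleC_add_right scaleC_add_left scaleC_scaleC scaleC_one)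

abbreviation clinear :: "('a::complex_vector \<Rightarrow> 'b::complex_vector) \<Rightarrow> bool"
  where "clinear \<equiv> Vector_Spaces.linear scaleC scaleC"

instantiation complex :: complex_vector
begin

definition scaleC_complex :: "complex \<Rightarrow> complex \<Rightarrow> complex"
  where "scaleC_complex = (*)"

instance
  by standard (simp_all add: scaleC_complex_def algebra_simps)

end

instantiation poly_mapping :: (type, complex_vector) complex_vector
begin

lift_definition scaleC_poly_mapping :: "complex \<Rightarrow> ('a \<Rightarrow>\<^sub>0 'b) \<Rightarrow> ('a \<Rightarrow>\<^sub>0 'b)"
  is "\<lambda>c f k. c *\<^sub>C f k"
proof -
  fix c :: complex and f :: "'a \<Rightarrow> 'b"
  assume "finite {k. f k \<noteq> 0}"
  then show "finite {k. c *\<^sub>C f k \<noteq> 0}"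
    by (rule rev_finite_subset) auto
qed

instance
  by standard
    (transfer; simp add: fun_eq_iff scaleC_add_right scaleC_add_left scaleC_scaleC scaleC_one)+

end

class quadratic_space = complex_vector +
  fixes form :: "'a \<Rightarrow> 'a \<Rightarrow> complex"
  assumes finite_dimensional: "\<exists>B. finite B \<and> (\<forall>x. \<exists>c. x = (\<Sum>b\<in>B. c b *\<^sub>C b))"
    and form_add_left: "form (x + y) z = form x z + form y z"
    and form_scaleC_left: "form (c *\<^sub>C x) z = c * form x z"
    and form_commute: "form x y = form y x"
    and form_nondegenerate: "(\<And>y. form x y = 0) \<Longrightarrow> x = 0"

definition orthogonal_group :: "('h::quadratic_space \<Rightarrow> 'h) set"
  where "orthogonal_group = {g. clinear g \<and> bij g \<and> (\<forall>x y. form (g x) (g y) = form x y)}"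

definition orthonormal_basis :: "'h::quadratic_space set \<Rightarrow> bool"
  where "orthonormal_basis B \<longleftrightarrow> finite B \<and> complex_vector.span B = UNIV \<and>
    (\<forall>x\<in>B. \<forall>y\<in>B. form x y = (if x = y then 1 else 0))"


section \<open>Lie algebras and universal enveloping algebras\<close>

class lie_algebra = complex_vector +
  fixes bracket :: "'a \<Rightarrow> 'a \<Rightarrow> 'a"
  assumes bracket_add_left: "bracket (x + y) z = bracket x z + bracket y z"
    and bracket_add_right: "bracket x (y + z) = bracket x y + bracket x z"
    and bracket_scaleC_left: "bracket (c *\<^sub>C x) y = c *\<^sub>C bracket x y"
    and bracket_scaleC_right: "bracket x (c *\<^sub>C y) = c *\<^sub>C bracket x y"
    and bracket_self: "bracket x x = 0"
    and bracket_jacobi: "bracket x (bracket y z) + bracket y (bracket z x) + bracket z (bracket x y) = 0"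

text \<open>
  Words form a free monoid (written additively), so \<open>'a word \<Rightarrow>\<^sub>0 complex\<close>, with the convolution
  product of \<^theory>\<open>HOL-Library.Poly_Mapping\<close>, is the free associative algebra on the set \<open>'a\<close>.
\<close>

datatype 'a word = Word (letters: "'a list")

instantiation word :: (type) monoid_add
begin

definition zero_word :: "'a word"
  where "zero_word = Word []"

definition plus_word :: "'a word \<Rightarrow> 'a word \<Rightarrow> 'a word"
  where "plus_word v w = Word (letters v @ letters w)"

instance
  by standard (simp_all add: zero_word_def plus_word_def)

end

definition gen :: "'a \<Rightarrow> ('a word \<Rightarrow>\<^sub>0 complex)"
  where "gen x = Poly_Mapping.single (Word [x]) 1"

inductive_set uea_relations :: "('g::lie_algebra word \<Rightarrow>\<^sub>0 complex) set" where
  "gen (x + y) - gen x - gen y \<in> uea_relations"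
| "gen (c *\<^sub>C x) - c *\<^sub>C gen x \<in> uea_relations"
| "gen x * gen y - gen y * gen x - gen (bracket x y) \<in> uea_relations"

definition uea_ideal :: "('g::lie_algebra word \<Rightarrow>\<^sub>0 complex) set"
  where "uea_ideal = complex_vector.span {a * r * b | a r b. r \<in> uea_relations}"

lemma equivp_diff_span: "equivp (\<lambda>a b. a - b \<in> complex_vector.span S)"
proof (rule equivpI)
  show "reflp (\<lambda>a b. a - b \<in> complex_vector.span S)"
    by (simp add: reflp_def complex_vector.span_zero)
  show "symp (\<lambda>a b. a - b \<in> complex_vector.span S)"
  proof (rule sympI)
    fix x y
    assume "x - y \<in> complex_vector.span S"
    then have "- (x - y) \<in> complex_vector.span S"
      by (rule complex_vector.span_neg)
    then show "y - x \<in> complex_vector.span S"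
      by simp
  qed
  show "transp (\<lambda>a b. a - b \<in> complex_vector.span S)"
  proof (rule transpI)
    fix x y z
    assume "x - y \<in> complex_vector.span S" "y - z \<in> complex_vector.span S"
    then have "(x - y) + (y - z) \<in> complex_vector.span S"
      by (rule complex_vector.span_add)
    then show "x - z \<in> complex_vector.span S"
      by simp
  qed
qed

lemma span_diff_congs:
  fixes S :: "'a::complex_vector set"
  assumes "a - b \<in> complex_vector.span S"
  shows span_diff_uminus: "- a - - b \<in> complex_vector.span S"
    and span_diff_scaleC: "k *\<^sub>C a - k *\<^sub>C b \<in> complex_vector.span S"
    and span_diff_plus: "c - d \<in> complex_vector.span S \<Longrightarrow> (a + c) - (b + d) \<in> complex_vector.span S"
    and span_diff_minus: "c - d \<in> complex_vector.span S \<Longrightarrow> (a - c) - (b - d) \<in> complex_vector.span S"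
proof -
  show "- a - - b \<in> complex_vector.span S"
    using complex_vector.span_neg[OF assms] by simp
  show "k *\<^sub>C a - k *\<^sub>C b \<in> complex_vector.span S"
    using complex_vector.span_scale[OF assms, of k]
    by (simp only: complex_vector.scale_right_diff_distrib)
  assume "c - d \<in> complex_vector.span S"
  note * = complex_vector.span_add[OF assms this] complex_vector.span_diff[OF assms this]
  show "(a + c) - (b + d) \<in> complex_vector.span S" "(a - c) - (b - d) \<in> complex_vector.span S"
    using * by (simp_all add: algebra_simps)
qed

lemma span_mapI:
  assumes "x \<in> complex_vector.span S" and "f 0 = 0"
    and "\<And>x y. f (x + y) = f x + f y" and "\<And>c x. f (c *\<^sub>C x) = c *\<^sub>C f x"
    and "\<And>x. x \<in> S \<Longrightarrow> f x \<in> complex_vector.span T"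
  shows "f x \<in> complex_vector.span T"
  using assms(1)
proof (induction rule: complex_vector.span_induct_alt)
  case base
  then show ?case
    using assms(2) complex_vector.span_zero by simp
next
  case (step c x y)
  then show ?case
    using assms by (simp add: complex_vector.span_add complex_vector.span_scale)
qed

lemma scaleC_single: "c *\<^sub>C Poly_Mapping.single k v = Poly_Mapping.single k (c * v)"
  by (rule poly_mapping_eqI)
    (simp add: scaleC_poly_mapping.rep_eq lookup_single scaleC_complex_def when_def)

lemma poly_mapping_induct:
  fixes p :: "'a \<Rightarrow>\<^sub>0 'b::monoid_add"
  assumes "P 0" and "\<And>k v p. P p \<Longrightarrow> P (Poly_Mapping.single k v + p)"
  shows "P p"
proof (induction p rule: Poly_Mapping.update_induct)
  case const
  then show ?case
    using assms(1) .
next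
  case (update p k v)
  have "Poly_Mapping.update k v p = Poly_Mapping.single k v + p"
    using update(1)
    by (intro poly_mapping_eqI)
      (auto simp: lookup_update lookup_add lookup_single when_def in_keys_iff)
  then show ?case
    using assms(2) update by simp
qed

lemma single_0_times:
  "Poly_Mapping.single 0 c * a = c *\<^sub>C (a :: 'a word \<Rightarrow>\<^sub>0 complex)"
  by (induction a rule: poly_mapping_induct)
    (simp_all add: mult_single scaleC_single distrib_left scaleC_add_right)

lemma times_single_0:
  "a * Poly_Mapping.single 0 c = c *\<^sub>C (a :: 'a word \<Rightarrow>\<^sub>0 complex)"
  by (induction a rule: poly_mapping_induct)
    (simp_all add: mult_single scaleC_single distrib_right scaleC_add_right mult.commute)

lemma free_scaleC_left: "(c *\<^sub>C a) * b = c *\<^sub>C (a * b)"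
  for a b :: "'a word \<Rightarrow>\<^sub>0 complex"
  by (simp flip: single_0_times add: mult.assoc)

lemma free_scaleC_right: "a * (c *\<^sub>C b) = c *\<^sub>C (a * b)"
  for a b :: "'a word \<Rightarrow>\<^sub>0 complex"
  by (simp flip: times_single_0 add: mult.assoc)

lemma uea_ideal_mult_left:
  assumes "x \<in> uea_ideal"
  shows "c * x \<in> uea_ideal"
  using assms unfolding uea_ideal_def
proof (rule span_mapI[where f = "\<lambda>x. c * x"])
  fix y :: "'a word \<Rightarrow>\<^sub>0 complex"
  assume "y \<in> {a * r * b | a r b. r \<in> uea_relations}"
  then obtain a r b where "y = a * r * b" "r \<in> uea_relations"
    by blast
  then have "c * y = (c * a) * r * b"
    by (simp add: mult.assoc)
  with \<open>r \<in> uea_relations\<close>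
  show "c * y \<in> complex_vector.span {a * r * b | a r b. r \<in> uea_relations}"
    by (intro complex_vector.span_base) blast
qed (simp_all add: distrib_left free_scaleC_right)

lemma uea_ideal_mult_right:
  assumes "x \<in> uea_ideal"
  shows "x * c \<in> uea_ideal"
  using assms unfolding uea_ideal_def
proof (rule span_mapI[where f = "\<lambda>x. x * c"])
  fix y :: "'a word \<Rightarrow>\<^sub>0 complex"
  assume "y \<in> {a * r * b | a r b. r \<in> uea_relations}"
  then obtain a r b where "y = a * r * b" "r \<in> uea_relations"
    by blast
  then have "y * c = a * r * (b * c)"
    by (simp add: mult.assoc)
  with \<open>r \<in> uea_relations\<close>
  show "y * c \<in> complex_vector.span {a * r * b | a r b. r \<in> uea_relations}"
    by (intro complex_vector.span_base) blast
qed (simp_all add: distrib_right free_scaleC_left)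

quotient_type (overloaded) 'g uea = "'g::lie_algebra word \<Rightarrow>\<^sub>0 complex" / "\<lambda>a b. a - b \<in> uea_ideal"
  unfolding uea_ideal_def by (rule equivp_diff_span)

instantiation uea :: (lie_algebra) "{ring, monoid_mult, complex_vector}"
begin

lift_definition zero_uea :: "'a uea" is 0 .

lift_definition one_uea :: "'a uea" is 1 .

lift_definition plus_uea :: "'a uea \<Rightarrow> 'a uea \<Rightarrow> 'a uea" is "(+)"
  unfolding uea_ideal_def by (rule span_diff_plus)

lift_definition minus_uea :: "'a uea \<Rightarrow> 'a uea \<Rightarrow> 'a uea" is "(-)"
  unfolding uea_ideal_def by (rule span_diff_minus)

lift_definition uminus_uea :: "'a uea \<Rightarrow> 'a uea" is uminus
  unfolding uea_ideal_def by (rule span_diff_uminus)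

lift_definition times_uea :: "'a uea \<Rightarrow> 'a uea \<Rightarrow> 'a uea" is "(*)"
proof -
  fix a b c d :: "'a word \<Rightarrow>\<^sub>0 complex"
  assume "a - b \<in> uea_ideal" "c - d \<in> uea_ideal"
  then have "(a - b) * c \<in> uea_ideal" "b * (c - d) \<in> uea_ideal"
    by (simp_all add: uea_ideal_mult_left uea_ideal_mult_right)
  then have "(a - b) * c + b * (c - d) \<in> uea_ideal"
    unfolding uea_ideal_def by (rule complex_vector.span_add)
  then show "a * c - b * d \<in> uea_ideal"
    by (simp add: algebra_simps)
qed

lift_definition scaleC_uea :: "complex \<Rightarrow> 'a uea \<Rightarrow> 'a uea" is scaleC
  unfolding uea_ideal_def by (rule span_diff_scaleC)

instance
  by standard
    (transfer; simp add: uea_ideal_def complex_vector.span_zero algebra_simps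
      scaleC_add_right scaleC_add_left scaleC_scaleC scaleC_one)+

end

lift_definition uea_of :: "'g::lie_algebra \<Rightarrow> 'g uea" is gen .


section \<open>The Heisenberg Lie algebra\<close>

text \<open>
  \<open>Heis f c\<close> is the element \<open>(\<Sum>n. t\<^sup>n \<otimes> f n) + c C\<close> of \<open>\<complex>[t,t\<^sup>-\<^sup>1] \<otimes> \<hh> \<oplus> \<complex>C\<close>.
\<close>

context
  notes [[typedef_overloaded]]
begin

datatype (dead 'h::zero) heis = Heis (loop_part: "int \<Rightarrow>\<^sub>0 'h") (central_part: complex)

end

abbreviation loop_coeff :: "'h::zero heis \<Rightarrow> int \<Rightarrow> 'h"
  where "loop_coeff x \<equiv> Poly_Mapping.lookup (loop_part x)"

abbreviation loop_support :: "'h::zero heis \<Rightarrow> int set"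
  where "loop_support x \<equiv> Poly_Mapping.keys (loop_part x)"

instantiation heis :: (complex_vector) complex_vector
begin

definition zero_heis :: "'a heis"
  where "zero_heis = Heis 0 0"

definition plus_heis :: "'a heis \<Rightarrow> 'a heis \<Rightarrow> 'a heis"
  where "plus_heis x y = Heis (loop_part x + loop_part y) (central_part x + central_part y)"

definition minus_heis :: "'a heis \<Rightarrow> 'a heis \<Rightarrow> 'a heis"
  where "minus_heis x y = Heis (loop_part x - loop_part y) (central_part x - central_part y)"

definition uminus_heis :: "'a heis \<Rightarrow> 'a heis"
  where "uminus_heis x = Heis (- loop_part x) (- central_part x)"

definition scaleC_heis :: "complex \<Rightarrow> 'a heis \<Rightarrow> 'a heis"
  where "scaleC_heis c x = Heis (c *\<^sub>C loop_part x) (c * central_part x)"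

instance
  by standard
    (simp_all add: zero_heis_def plus_heis_def minus_heis_def uminus_heis_def scaleC_heis_def
      heis.expand algebra_simps scaleC_add_right scaleC_add_left scaleC_scaleC scaleC_one)

end

lemma form_zero_left [simp]: "form 0 z = 0"
  using form_add_left[of 0 0 z] by simp

lemma form_zero_right [simp]: "form z 0 = 0"
  by (metis form_commute form_zero_left)

lemma form_add_right: "form z (x + y) = form z x + form z y"
  by (metis form_commute form_add_left)

lemma form_scaleC_right: "form z (c *\<^sub>C x) = c * form z x"
  by (metis form_commute form_scaleC_left)

instantiation heis :: (quadratic_space) lie_algebra
begin

definition bracket_heis :: "'a heis \<Rightarrow> 'a heis \<Rightarrow> 'a heis"
  where "bracket_heis x y = Heis 0
    (\<Sum>m\<in>loop_support x. of_int m * form (loop_coeff x m) (loop_coeff y (- m)))"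

lemma bracket_heis_superset:
  assumes "finite K" "loop_support x \<subseteq> K"
  shows "bracket x y = Heis 0
    (\<Sum>m\<in>K. of_int m * form (loop_coeff x m) (loop_coeff y (- m)))"
  unfolding bracket_heis_def heis.inject
  by (intro conjI refl sum.mono_neutral_left) (use assms in \<open>auto simp: in_keys_iff\<close>)

instance
proof
  fix x y z :: "'a heis" and c
  define K where "K = loop_support x \<union> loop_support y \<union> loop_support z \<union>
    loop_support (x + y) \<union> loop_support (c *\<^sub>C x)"
  have fin: "finite K"
    by (simp add: K_def)
  have K: "loop_support x \<subseteq> K" "loop_support y \<subseteq> K" "loop_support z \<subseteq> K"
    "loop_support (x + y) \<subseteq> K" "loop_support (c *\<^sub>C x) \<subseteq> K"
    by (auto simp: K_def)
  note expand = K[THEN bracket_heis_superset[OF fin]]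
  show "bracket (x + y) z = bracket x z + bracket y z"
    unfolding expand
    by (simp add: plus_heis_def lookup_add form_add_left algebra_simps sum.distrib)
  show "bracket x (y + z) = bracket x y + bracket x z"
    unfolding expand
    by (simp add: plus_heis_def lookup_add form_add_right algebra_simps sum.distrib)
  show "bracket (c *\<^sub>C x) y = c *\<^sub>C bracket x y"
    unfolding expand
    by (simp add: scaleC_heis_def scaleC_poly_mapping.rep_eq form_scaleC_left sum_distrib_left
        algebra_simps)
  show "bracket x (c *\<^sub>C y) = c *\<^sub>C bracket x y"
    unfolding expand
    by (simp add: scaleC_heis_def scaleC_poly_mapping.rep_eq form_scaleC_right sum_distrib_left
        algebra_simps)
  show "bracket x x = 0"
  proof -
    define J where "J = loop_support x \<union> uminus ` loop_support x"
    define f where "f m = of_int m * form (loop_coeff x m) (loop_coeff x (- m))" for m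
    have J: "finite J" "loop_support x \<subseteq> J" "uminus ` J = J"
      by (auto simp: J_def image_Un image_image)
    have "sum f J = (\<Sum>m\<in>J. f (- m))"
      using sum.reindex[of uminus J f] J(3) by (simp add: o_def)
    also have "\<dots> = - sum f J"
      unfolding sum_negf[symmetric] by (rule sum.cong) (simp_all add: f_def form_commute)
    finally have "sum f J = 0"
      by simp
    then show ?thesis
      using bracket_heis_superset[OF J(1,2), of x] by (simp add: f_def zero_heis_def)
  qed
  show "bracket x (bracket y z) + bracket y (bracket z x) + bracket z (bracket x y) = 0"
    by (simp add: bracket_heis_def zero_heis_def plus_heis_def)
qed

end

definition loop :: "'h::zero \<Rightarrow> int \<Rightarrow> 'h heis"
  where "loop u n = Heis (Poly_Mapping.single n u) 0"

definition heis_nonneg :: "'h::zero heis set"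
  where "heis_nonneg = {x. \<forall>n<0. loop_coeff x n = 0}"


section \<open>The induced module\<close>

text \<open>
  The tensor product \<open>U \<otimes> \<complex>\<one>\<close> over \<open>U(heis_nonneg)\<close> is the quotient of \<open>U\<close> by
  the relations \<open>a x \<otimes> \<one> = a \<otimes> x \<one>\<close> for \<open>x \<in> heis_nonneg\<close>, where \<open>x \<one> = central_part x \<one>\<close>.
\<close>

definition vacuum_relations :: "'h::quadratic_space heis uea set"
  where "vacuum_relations =
    complex_vector.span {a * uea_of x - central_part x *\<^sub>C a | a x. x \<in> heis_nonneg}"

lemma uea_scaleC_right: "a * (c *\<^sub>C b) = c *\<^sub>C (a * b)" for a b :: "'g::lie_algebra uea"
  by transfer (simp add: free_scaleC_right uea_ideal_def complex_vector.span_zero)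

lemma vacuum_relations_mult_left:
  assumes "v \<in> vacuum_relations"
  shows "b * v \<in> vacuum_relations"
  using assms unfolding vacuum_relations_def
proof (rule span_mapI[where f = "\<lambda>v. b * v"])
  fix y :: "'a heis uea"
  assume "y \<in> {a * uea_of x - central_part x *\<^sub>C a | a x. x \<in> heis_nonneg}"
  then obtain a x where "y = a * uea_of x - central_part x *\<^sub>C a" "x \<in> heis_nonneg"
    by blast
  then have "b * y = (b * a) * uea_of x - central_part x *\<^sub>C (b * a)"
    by (simp add: right_diff_distrib uea_scaleC_right mult.assoc)
  with \<open>x \<in> heis_nonneg\<close>
  show "b * y \<in> complex_vector.span {a * uea_of x - central_part x *\<^sub>C a | a x. x \<in> heis_nonneg}"
    by (intro complex_vector.span_base) blast
qed (simp_all add: distrib_left uea_scaleC_right)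

(* From here on elements of uea are not to be unfolded into representatives by lifting. *)
lifting_forget uea.lifting

quotient_type (overloaded) 'h heis_vac = "'h::quadratic_space heis uea" /
    "\<lambda>a b. a - b \<in> vacuum_relations"
  unfolding vacuum_relations_def by (rule equivp_diff_span)

instantiation heis_vac :: (quadratic_space) complex_vector
begin

lift_definition zero_heis_vac :: "'a heis_vac" is 0 .

lift_definition plus_heis_vac :: "'a heis_vac \<Rightarrow> 'a heis_vac \<Rightarrow> 'a heis_vac" is "(+)"
  unfolding vacuum_relations_def by (rule span_diff_plus)

lift_definition minus_heis_vac :: "'a heis_vac \<Rightarrow> 'a heis_vac \<Rightarrow> 'a heis_vac" is "(-)"
  unfolding vacuum_relations_def by (rule span_diff_minus)

lift_definition uminus_heis_vac :: "'a heis_vac \<Rightarrow> 'a heis_vac" is uminus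
  unfolding vacuum_relations_def by (rule span_diff_uminus)

lift_definition scaleC_heis_vac :: "complex \<Rightarrow> 'a heis_vac \<Rightarrow> 'a heis_vac" is scaleC
  unfolding vacuum_relations_def by (rule span_diff_scaleC)

instance
  by standard
    (transfer; simp add: vacuum_relations_def complex_vector.span_zero algebra_simps
      scaleC_add_right scaleC_add_left scaleC_scaleC scaleC_one)+

end

lift_definition vacuum :: "'h::quadratic_space heis_vac" is 1 .

lift_definition uea_act :: "'h::quadratic_space heis uea \<Rightarrow> 'h heis_vac \<Rightarrow> 'h heis_vac" is "(*)"
  by (simp add: vacuum_relations_mult_left flip: right_diff_distrib)

definition mode :: "'h::quadratic_space \<Rightarrow> int \<Rightarrow> 'h heis_vac \<Rightarrow> 'h heis_vac"
  where "mode u n = uea_act (uea_of (loop u n))"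

definition standard_grade :: "nat \<Rightarrow> 'h::quadratic_space heis_vac set"
  where "standard_grade n = complex_vector.span
    {foldr (\<lambda>(u, k). mode u (- int k)) uks vacuum | uks.
      (\<forall>(u, k)\<in>set uks. k \<ge> 1) \<and> sum_list (map snd uks) = n}"


section \<open>Vertex algebras and vertex operator algebras\<close>

text \<open>
  \<open>Y u n\<close> is the coefficient \<open>u\<^sub>n\<close> in \<open>Y(u,z) = \<Sum>n. u\<^sub>n z\<^sup>-\<^sup>n\<^sup>-\<^sup>1\<close>.  The last axiom is
  the Jacobi identity, coefficient by coefficient; by truncation only finitely many terms of each
  sum over \<open>i :: nat\<close> are nonzero.
\<close>

locale vertex_algebra =
  fixes Y :: "'v::complex_vector \<Rightarrow> int \<Rightarrow> 'v \<Rightarrow> 'v" and vac :: 'v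
  assumes Y_linear_left: "clinear (\<lambda>u. Y u n v)"
    and Y_linear_right: "clinear (Y u n)"
    and truncation: "\<exists>N. \<forall>n\<ge>N. Y u n v = 0"
    and Y_vac: "Y vac n v = (if n = - 1 then v else 0)"
    and creation: "Y v (- 1) vac = v"  "n \<ge> 0 \<Longrightarrow> Y v n vac = 0"
    and jacobi:
      "Sum_any (\<lambda>i. ((- 1) ^ i * (of_int l gchoose i)) *\<^sub>C
          (Y u (m + l - int i) (Y v (n + int i) w)
            - ((- 1) powi l) *\<^sub>C Y v (n + l - int i) (Y u (m + int i) w)))
       = Sum_any (\<lambda>i. (of_int m gchoose i) *\<^sub>C Y (Y u (l + int i) v) (m + n - int i) w)"

text \<open>With \<open>Y(\<omega>,z) = \<Sum>n. L(n) z\<^sup>-\<^sup>n\<^sup>-\<^sup>2\<close>, the operator \<open>L(n)\<close> is \<open>Y \<omega> (n + 1)\<close>.\<close>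

locale vertex_operator_algebra = vertex_algebra Y vac
  for Y :: "'v::complex_vector \<Rightarrow> int \<Rightarrow> 'v \<Rightarrow> 'v" and vac :: 'v +
  fixes \<omega> :: 'v
  assumes virasoro: "\<exists>c. \<forall>m n v.
      Y \<omega> (m + 1) (Y \<omega> (n + 1) v) - Y \<omega> (n + 1) (Y \<omega> (m + 1) v)
      = of_int (m - n) *\<^sub>C Y \<omega> (m + n + 1) v
        + (if m + n = 0 then of_int (m ^ 3 - m) / 12 * c else 0) *\<^sub>C v"
    and L_minus_1_derivative: "Y (Y \<omega> 0 v) n w = - (of_int n *\<^sub>C Y v (n - 1) w)"
    and L0_weight_decomposition:
      "complex_vector.span (\<Union>n::int. {v. Y \<omega> 1 v = of_int n *\<^sub>C v}) = UNIV"
    and L0_weight_spaces_finite_dimensional: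
      "\<exists>B. finite B \<and> {v. Y \<omega> 1 v = of_int (n::int) *\<^sub>C v} \<subseteq> complex_vector.span B"
    and L0_weights_bounded_below:
      "\<exists>N::int. \<forall>n<N. {v. Y \<omega> 1 v = of_int n *\<^sub>C v} = {0}"

definition vertex_algebra_iso ::
  "('v::complex_vector \<Rightarrow> int \<Rightarrow> 'v \<Rightarrow> 'v) \<Rightarrow> 'v \<Rightarrow>
   ('w::complex_vector \<Rightarrow> int \<Rightarrow> 'w \<Rightarrow> 'w) \<Rightarrow> 'w \<Rightarrow> ('v \<Rightarrow> 'w) \<Rightarrow> bool"
  where "vertex_algebra_iso Y vac Y' vac' \<phi> \<longleftrightarrow>
    clinear \<phi> \<and> bij \<phi> \<and> \<phi> vac = vac' \<and> (\<forall>u n v. \<phi> (Y u n v) = Y' (\<phi> u) n (\<phi> v))"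

definition voa_isomorphic ::
  "('v::complex_vector \<Rightarrow> int \<Rightarrow> 'v \<Rightarrow> 'v) \<Rightarrow> 'v \<Rightarrow> 'v \<Rightarrow>
   ('w::complex_vector \<Rightarrow> int \<Rightarrow> 'w \<Rightarrow> 'w) \<Rightarrow> 'w \<Rightarrow> 'w \<Rightarrow> bool"
  where "voa_isomorphic Y vac \<omega> Y' vac' \<omega>' \<longleftrightarrow>
    (\<exists>\<phi>. vertex_algebra_iso Y vac Y' vac' \<phi> \<and> \<phi> \<omega> = \<omega>')"


section \<open>Conformal structures on the Heisenberg vertex algebra\<close>

text \<open>
  The vertex algebra structure with vacuum \<open>\<one>\<close> and \<open>Y(u(-1)\<one>,z) = \<Sum>n. u(n) z\<^sup>-\<^sup>n\<^sup>-\<^sup>1\<close>;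
  exactly one \<open>Y\<close> satisfies this predicate.
\<close>

definition heisenberg_vertex_algebra ::
  "('h::quadratic_space heis_vac \<Rightarrow> int \<Rightarrow> 'h heis_vac \<Rightarrow> 'h heis_vac) \<Rightarrow> bool"
  where "heisenberg_vertex_algebra Y \<longleftrightarrow>
    vertex_algebra Y vacuum \<and> (\<forall>u n. Y (mode u (- 1) vacuum) n = mode u n)"

text \<open>For an orthonormal basis \<open>B\<close> this does not depend on the choice of \<open>B\<close>.\<close>

definition omega :: "'h::quadratic_space set \<Rightarrow> 'h \<Rightarrow> 'h heis_vac"
  where "omega B h =
    (1 / 2) *\<^sub>C (\<Sum>b\<in>B. mode b (- 1) (mode b (- 1) vacuum)) + mode h (- 2) vacuum"

definition graded_conformal_structures ::
  "('h::quadratic_space heis_vac \<Rightarrow> int \<Rightarrow> 'h heis_vac \<Rightarrow> 'h heis_vac) \<Rightarrow> 'h heis_vac set"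
  where "graded_conformal_structures Y =
    {\<omega>. vertex_operator_algebra Y vacuum \<omega> \<and>
      (\<forall>n. \<forall>v\<in>standard_grade n. Y \<omega> 1 v = of_nat n *\<^sub>C v)}"

definition conformal_iso_rel ::
  "('h::quadratic_space heis_vac \<Rightarrow> int \<Rightarrow> 'h heis_vac \<Rightarrow> 'h heis_vac) \<Rightarrow>
   ('h heis_vac \<times> 'h heis_vac) set"
  where "conformal_iso_rel Y =
    {(\<omega>, \<omega>'). \<omega> \<in> graded_conformal_structures Y \<and> \<omega>' \<in> graded_conformal_structures Y \<and>
      voa_isomorphic Y vacuum \<omega> Y vacuum \<omega>'}"

definition orbit_rel :: "('h::quadratic_space \<times> 'h) set"
  where "orbit_rel = {(h, h'). \<exists>g\<in>orthogonal_group. h' = g h}"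

end

theory Submission
  imports Defs "HOL-Library.Function_Algebras" "HOL-Library.Multiset"
begin

text \<open>
  Everything is controlled by the operators \<open>u(n)\<close>.  A vector is reached from \<open>\<one>\<close> by such operators,
  and the case \<open>m = 0\<close> of the Jacobi identity expresses \<open>Y(u(l)v, z)\<close> through \<open>u(n)\<close> and
  \<open>Y(v, z)\<close>; so statements about all vertex operators reduce by induction to the operators \<open>u(n)\<close>, and
  these satisfy \<open>[u(m), v(n)] = m \<langle>u,v\<rangle> \<delta>\<^bsub>m+n,0\<^esub>\<close>.

  \<^emph>\<open>An isomorphism yields an orthogonal map.\<close>  For every \<open>h\<close> the operator \<open>L(0)\<close> of \<open>\<omega>\<^sub>h\<close> is the
  degree operator, so an isomorphism carrying \<open>\<omega>\<^sub>h\<close> to \<open>\<omega>\<^bsub>h'\<^esub>\<close> preserves the degree-one space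
  \<open>{u(-1)\<one>}\<close> and acts there as some \<open>g\<close> on \<open>\<hh>\<close>.  The identity \<open>u(1)v(-1)\<one> = \<langle>u,v\<rangle>\<one>\<close> makes \<open>g\<close>
  orthogonal, and \<open>u(2)\<omega>\<^sub>h = 2\<langle>u,h\<rangle>\<one>\<close>, through which \<open>\<omega>\<^sub>h\<close> remembers \<open>h\<close>, forces \<open>h' = g h\<close>.  Both
  conclusions require \<open>\<one> \<noteq> 0\<close>, which is shown by mapping the induced module to a Fock space.

  \<^emph>\<open>An orthogonal map yields an isomorphism.\<close>  The group acts on the Heisenberg Lie algebra, hence by
  the universal property of the induced module there is a linear map \<open>\<phi>\<close> with
  \<open>\<phi> u(n) = (g u)(n) \<phi>\<close>, and by the first paragraph \<open>\<phi>\<close> respects all vertex operators.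

  \<^emph>\<open>The \<open>\<omega>\<^sub>h\<close> are exactly the graded conformal vectors.\<close>  A vector \<open>v\<close> of degree two has the form
  \<open>1/2 \<Sum> b(-1)b(1)v + h(-2)\<one>\<close>, the sum being over an orthonormal basis; hence \<open>v\<close> is one of the
  \<open>\<omega>\<^sub>h\<close> as soon as \<open>u(1)v = u(-1)\<one>\<close> for all \<open>u\<close>.  A conformal vector \<open>\<omega>'\<close> whose \<open>L'(0)\<close> is the degree
  has this property: the commutator \<open>[u(1), L'(0)]\<close> equals \<open>u(1)\<close> because \<open>L'(0)\<close> is the degree, and
  equals the mode \<open>(u(1)\<omega>')\<^sub>1\<close> by the commutator formula.  In the other direction the commutators of
  the modes of \<open>\<omega>\<^sub>h\<close> with \<open>u(m)\<close>, and then with each other, are read off from the finitely many vectors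
  \<open>u(i)\<omega>\<^sub>h\<close> and \<open>L(i)\<omega>\<^sub>h\<close>; the central charge is \<open>dim \<hh> - 12\<langle>h,h\<rangle>\<close>.
\<close>

section \<open>The universal property of the induced module\<close>

lemma clinearI:
  assumes "\<And>x y. f (x + y) = f x + f y" and "\<And>c x. f (c *\<^sub>C x) = c *\<^sub>C f x"
  shows "clinear f"
  using assms by (auto intro!: Vector_Spaces.linear.intro complex_vector.vector_space_axioms
      simp: module_hom_axioms_def module_hom_def complex_vector.module_axioms)

lemma clinear_simps:
  assumes "clinear f"
  shows "f (x + y) = f x + f y" "f (c *\<^sub>C x) = c *\<^sub>C f x" "f 0 = 0" "f (- x) = - f x"
    "f (x - y) = f x - f y"  "f (\<Sum>i\<in>I. g i) = (\<Sum>i\<in>I. f (g i))"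
proof -
  interpret Vector_Spaces.linear scaleC scaleC f by fact
  show "f (x + y) = f x + f y" "f (c *\<^sub>C x) = c *\<^sub>C f x" "f 0 = 0" "f (- x) = - f x"
    "f (x - y) = f x - f y"  "f (\<Sum>i\<in>I. g i) = (\<Sum>i\<in>I. f (g i))"
    by (fact add scale zero neg diff sum)+
qed

lemma uea_of_add: "uea_of (x + y) = uea_of x + uea_of y"
  and uea_of_scaleC: "uea_of (c *\<^sub>C x) = c *\<^sub>C uea_of x"
  and uea_of_bracket: "uea_of x * uea_of y = uea_of y * uea_of x + uea_of (bracket x y)"
proof -
  have rel: "r \<in> uea_ideal" if "r \<in> uea_relations" for r :: "'a word \<Rightarrow>\<^sub>0 complex"
    unfolding uea_ideal_def using that
    by (intro complex_vector.span_base CollectI exI[of _ 1] exI[of _ r]) simp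
  note abs_eq = uea_of.abs_eq plus_uea.abs_eq scaleC_uea.abs_eq times_uea.abs_eq uea.abs_eq_iff
  show "uea_of (x + y) = uea_of x + uea_of y"
    using rel[OF uea_relations.intros(1)[of x y]] by (simp add: abs_eq algebra_simps)
  show "uea_of (c *\<^sub>C x) = c *\<^sub>C uea_of x"
    using rel[OF uea_relations.intros(2)[of c x]] by (simp add: abs_eq)
  show "uea_of x * uea_of y = uea_of y * uea_of x + uea_of (bracket x y)"
    using rel[OF uea_relations.intros(3)[of x y]] by (simp add: abs_eq algebra_simps)
qed

lemma abs_uea_surj: "\<exists>p. a = abs_uea p"
  by (metis Quotient_abs_rep[OF Quotient_uea])

lemma uea_scaleC_left: "(c *\<^sub>C a) * b = c *\<^sub>C (a * b)" for a b :: "'g::lie_algebra uea"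
proof -
  obtain p q where "a = abs_uea p" "b = abs_uea q"
    using abs_uea_surj by metis
  then show ?thesis
    by (simp add: scaleC_uea.abs_eq times_uea.abs_eq free_scaleC_left)
qed

lemma uea_act_add: "uea_act (a + b) v = uea_act a v + uea_act b v"
  by transfer (simp add: distrib_right vacuum_relations_def complex_vector.span_zero)

lemma uea_act_scaleC: "uea_act (c *\<^sub>C a) v = c *\<^sub>C uea_act a v"
  by transfer (simp add: uea_scaleC_left vacuum_relations_def complex_vector.span_zero)

lemma uea_act_mult: "uea_act (a * b) v = uea_act a (uea_act b v)"
  by transfer (simp add: mult.assoc vacuum_relations_def complex_vector.span_zero)

lemma uea_act_one: "uea_act 1 v = v"
  by transfer (simp add: vacuum_relations_def complex_vector.span_zero)

lemma uea_act_vacuum_surj: "\<exists>a. v = uea_act a vacuum"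
proof (transfer)
  fix v :: "'a heis uea"
  show "\<exists>a. v - a * 1 \<in> vacuum_relations"
    by (rule exI[of _ v]) (simp add: vacuum_relations_def complex_vector.span_zero)
qed

lemma uea_act_clinear: "clinear (uea_act a)"
proof (rule clinearI)
  show "uea_act a (x + y) = uea_act a x + uea_act a y" for x y
    by transfer (simp add: distrib_left vacuum_relations_def complex_vector.span_zero)
  show "uea_act a (c *\<^sub>C x) = c *\<^sub>C uea_act a x" for c x
    by transfer (simp add: uea_scaleC_right vacuum_relations_def complex_vector.span_zero)
qed

definition heis_act :: "'h::quadratic_space heis \<Rightarrow> 'h heis_vac \<Rightarrow> 'h heis_vac"
  where "heis_act x = uea_act (uea_of x)"

lemma mode_eq_heis_act: "mode u n = heis_act (loop u n)"
  by (simp add: mode_def heis_act_def)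

lemma heis_act_vacuum:
  assumes "x \<in> heis_nonneg"
  shows "heis_act x vacuum = central_part x *\<^sub>C vacuum"
  unfolding heis_act_def
proof (transfer fixing: x)
  have "1 * uea_of x - central_part x *\<^sub>C 1 \<in> vacuum_relations"
    unfolding vacuum_relations_def using assms by (intro complex_vector.span_base) blast
  then show "uea_of x * 1 - central_part x *\<^sub>C 1 \<in> vacuum_relations" by simp
qed

locale lie_representation =
  fixes \<rho> :: "'g::lie_algebra \<Rightarrow> 'w::complex_vector \<Rightarrow> 'w"
  assumes rep_clinear: "clinear (\<rho> x)"
    and rep_add: "\<rho> (x + y) w = \<rho> x w + \<rho> y w"
    and rep_scaleC: "\<rho> (c *\<^sub>C x) w = c *\<^sub>C \<rho> x w"
    and rep_bracket: "\<rho> (bracket x y) w = \<rho> x (\<rho> y w) - \<rho> y (\<rho> x w)"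
begin

text \<open>The extension of the representation to the free associative algebra on \<open>'g\<close>.\<close>
definition free_act :: "('g word \<Rightarrow>\<^sub>0 complex) \<Rightarrow> 'w \<Rightarrow> 'w"
  where "free_act p w = (\<Sum>k\<in>Poly_Mapping.keys p. Poly_Mapping.lookup p k *\<^sub>C foldr \<rho> (letters k) w)"

lemma free_act_superset:
  assumes "finite K" "Poly_Mapping.keys p \<subseteq> K"
  shows "free_act p w = (\<Sum>k\<in>K. Poly_Mapping.lookup p k *\<^sub>C foldr \<rho> (letters k) w)"
  unfolding free_act_def
  by (intro sum.mono_neutral_left) (use assms in \<open>auto simp: in_keys_iff\<close>)

lemma free_act_zero: "free_act 0 w = 0"
  by (simp add: free_act_def)

lemma free_act_add: "free_act (p + q) w = free_act p w + free_act q w"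
proof -
  define K where "K = Poly_Mapping.keys p \<union> Poly_Mapping.keys q"
  have "finite K" "Poly_Mapping.keys p \<subseteq> K" "Poly_Mapping.keys q \<subseteq> K"
    "Poly_Mapping.keys (p + q) \<subseteq> K"
    using Poly_Mapping.keys_add[of p q] by (auto simp: K_def)
  then show ?thesis
    by (simp add: free_act_superset[of K] lookup_add scaleC_add_left sum.distrib)
qed

lemma free_act_scaleC: "free_act (c *\<^sub>C p) w = c *\<^sub>C free_act p w"
proof -
  have "Poly_Mapping.keys (c *\<^sub>C p) \<subseteq> Poly_Mapping.keys p"
    by (auto simp: in_keys_iff scaleC_poly_mapping.rep_eq scaleC_complex_def)
  then show ?thesis
    by (simp add: free_act_superset[of "Poly_Mapping.keys p"] scaleC_poly_mapping.rep_eq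
        scaleC_complex_def complex_vector.scale_sum_right flip: scaleC_scaleC)
qed

lemma free_act_clinear_left: "clinear (\<lambda>p. free_act p w)"
  by (rule clinearI) (simp_all add: free_act_add free_act_scaleC)

lemma foldr_rep_clinear: "clinear (foldr \<rho> xs)"
proof (induction xs)
  case (Cons x xs)
  then show ?case
    by (intro clinearI) (simp_all add: clinear_simps[OF rep_clinear] clinear_simps)
qed (auto intro: clinearI)

lemma free_act_clinear: "clinear (free_act p)"
  unfolding free_act_def
  by (intro clinearI)
    (simp_all add: clinear_simps[OF foldr_rep_clinear] scaleC_add_right sum.distrib
      complex_vector.scale_sum_right scaleC_scaleC mult.commute)

lemma free_act_single: "free_act (Poly_Mapping.single k c) w = c *\<^sub>C foldr \<rho> (letters k) w"
  by (simp add: free_act_superset[of "{k}"])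

lemma free_act_mult: "free_act (p * q) w = free_act p (free_act q w)"
proof (induction p rule: poly_mapping_induct)
  case 1
  then show ?case by (simp add: free_act_zero)
next
  case (2 k c p)
  have "free_act (Poly_Mapping.single k c * q) w = free_act (Poly_Mapping.single k c) (free_act q w)"
    by (induction q rule: poly_mapping_induct)
      (simp_all add: free_act_zero free_act_add distrib_left mult_single free_act_single
        clinear_simps[OF foldr_rep_clinear] plus_word_def scaleC_add_right scaleC_scaleC)
  with 2 show ?case by (simp add: distrib_right free_act_add)
qed

lemma free_act_gen: "free_act (gen x) w = \<rho> x w"
  by (simp add: gen_def free_act_single scaleC_one)

text \<open>
  On each generating relation this is one of the three axioms of a representation; multiplying a
  relation on either side only composes the zero operator with others.
\<close>
lemma free_act_ideal:
  assumes "p \<in> uea_ideal"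
  shows "free_act p w = 0"
  using assms unfolding uea_ideal_def
proof (induction rule: complex_vector.span_induct_alt)
  case base
  then show ?case by (simp add: free_act_zero)
next
  case (step c p q)
  then obtain a r b where p: "p = a * r * b" and r: "r \<in> uea_relations" by blast
  from r have "free_act r v = 0" for v
    by cases (simp_all add: clinear_simps[OF free_act_clinear_left] free_act_gen rep_add rep_scaleC
        rep_bracket free_act_mult)
  then show ?case
    using step by (simp add: p free_act_add free_act_scaleC free_act_mult clinear_simps[OF free_act_clinear])
qed

text \<open>
  The choice of representative is harmless, since the free algebra acts through its quotient.
\<close>
definition uea_ext :: "'g uea \<Rightarrow> 'w \<Rightarrow> 'w"
  where "uea_ext a w = free_act (rep_uea a) w"

lemma uea_ext_abs: "uea_ext (abs_uea p) w = free_act p w"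
proof -
  have "rep_uea (abs_uea p) - p \<in> uea_ideal"
    by (simp add: Quotient_abs_rep[OF Quotient_uea] flip: uea.abs_eq_iff)
  from free_act_ideal[OF this, of w] show ?thesis
    by (simp add: uea_ext_def clinear_simps[OF free_act_clinear_left])
qed

lemma uea_ext_simps:
  "uea_ext (a + b) w = uea_ext a w + uea_ext b w"
  "uea_ext (c *\<^sub>C a) w = c *\<^sub>C uea_ext a w"
  "uea_ext (a * b) w = uea_ext a (uea_ext b w)"
  "uea_ext 1 w = w"
  "uea_ext (uea_of x) w = \<rho> x w"
proof -
  obtain p q where a: "a = abs_uea p" and b: "b = abs_uea q"
    using abs_uea_surj by metis
  show "uea_ext (a + b) w = uea_ext a w + uea_ext b w"
    by (simp add: a b plus_uea.abs_eq uea_ext_abs free_act_add)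
  show "uea_ext (c *\<^sub>C a) w = c *\<^sub>C uea_ext a w"
    by (simp add: a scaleC_uea.abs_eq uea_ext_abs free_act_scaleC)
  show "uea_ext (a * b) w = uea_ext a (uea_ext b w)"
    by (simp add: a b times_uea.abs_eq uea_ext_abs free_act_mult)
  show "uea_ext 1 w = w"
    by (simp add: one_uea.abs_eq uea_ext_abs free_act_single scaleC_one zero_word_def flip: single_one)
  show "uea_ext (uea_of x) w = \<rho> x w"
    by (simp add: uea_of.abs_eq uea_ext_abs free_act_gen)
qed

lemma uea_ext_clinear: "clinear (uea_ext a)" "clinear (\<lambda>a. uea_ext a w)"
  unfolding uea_ext_def[of a, abs_def]
  by (fact free_act_clinear) (intro clinearI uea_ext_simps)

end

text \<open>Words in the generators span the enveloping algebra.\<close>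
lemma uea_induct:
  fixes a :: "'g::lie_algebra uea"
  assumes "P 0" "P 1" "\<And>a b. P a \<Longrightarrow> P b \<Longrightarrow> P (a + b)" "\<And>c a. P a \<Longrightarrow> P (c *\<^sub>C a)"
    "\<And>x a. P a \<Longrightarrow> P (uea_of x * a)"
  shows "P a"
proof -
  have w: "P (abs_uea (Poly_Mapping.single (Word xs) 1))" for xs
  proof (induction xs)
    case Nil
    then show ?case
      using assms(2) by (simp add: one_uea.abs_eq flip: single_one zero_word_def)
  next
    case (Cons x xs)
    have "abs_uea (Poly_Mapping.single (Word (x # xs)) 1)
       = uea_of x * abs_uea (Poly_Mapping.single (Word xs) 1)"
      by (simp add: uea_of.abs_eq times_uea.abs_eq gen_def mult_single plus_word_def)
    with Cons assms(5) show ?case by simp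
  qed
  have "P (abs_uea p)" for p
  proof (induction p rule: poly_mapping_induct)
    case 1
    then show ?case using assms(1) by (simp add: zero_uea.abs_eq)
  next
    case (2 k c p)
    have "Poly_Mapping.single k c = c *\<^sub>C Poly_Mapping.single (Word (letters k)) 1"
      by (simp add: scaleC_single)
    then have "P (abs_uea (Poly_Mapping.single k c))"
      using assms(4)[OF w[of "letters k"], of c] by (simp add: scaleC_uea.abs_eq)
    with 2 assms(3) show ?case by (simp flip: plus_uea.abs_eq)
  qed
  then show ?thesis
    using abs_uea_surj by metis
qed

lemma heis_vac_induct:
  assumes "P 0" "P vacuum" "\<And>v w. P v \<Longrightarrow> P w \<Longrightarrow> P (v + w)" "\<And>c v. P v \<Longrightarrow> P (c *\<^sub>C v)"
    "\<And>x v. P v \<Longrightarrow> P (heis_act x v)"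
  shows "P v"
proof -
  have "P (uea_act a vacuum)" for a
  proof (induction a rule: uea_induct)
    case 1
    have "uea_act 0 v = 0" for v :: "'a heis_vac"
      using uea_act_scaleC[of 0 0 v] by simp
    then show ?case using assms by simp
  qed (use assms in \<open>simp_all add: uea_act_one uea_act_add uea_act_scaleC uea_act_mult heis_act_def\<close>)
  then show ?thesis using uea_act_vacuum_surj by metis
qed

text \<open>
  Frobenius reciprocity: a homomorphism out of the induced module is a vector \<open>w\<close> on which the
  nonnegative part acts as it does on \<open>\<one>\<close>.  This is used for the Fock space, to see that \<open>\<one> \<noteq> 0\<close>,
  and for the induced module twisted by an orthogonal map.
\<close>
lemma heis_vac_universal:
  fixes \<rho> :: "'h::quadratic_space heis \<Rightarrow> 'w::complex_vector \<Rightarrow> 'w"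
  assumes "lie_representation \<rho>"
    and vac: "\<And>x. x \<in> heis_nonneg \<Longrightarrow> \<rho> x w = central_part x *\<^sub>C w"
  obtains \<psi> where "clinear \<psi>" "\<psi> vacuum = w" "\<And>x v. \<psi> (heis_act x v) = \<rho> x (\<psi> v)"
proof -
  interpret lie_representation \<rho> by fact
  have 0: "uea_ext a w = 0" if "a \<in> vacuum_relations" for a
    using that unfolding vacuum_relations_def
  proof (induction rule: complex_vector.span_induct_alt)
    case base
    then show ?case by (fact clinear_simps(3)[OF uea_ext_clinear(2)])
  next
    case (step c x y)
    then obtain a z where "x = a * uea_of z - central_part z *\<^sub>C a" "z \<in> heis_nonneg"
      by blast
    then show ?case
      using step(2) by (simp add: uea_ext_simps clinear_simps[OF uea_ext_clinear(2)] vac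
          clinear_simps[OF uea_ext_clinear(1)])
  qed
  define \<psi> where "\<psi> v = uea_ext (rep_heis_vac v) w" for v
  have abs: "\<psi> (abs_heis_vac a) = uea_ext a w" for a
  proof -
    have "rep_heis_vac (abs_heis_vac a) - a \<in> vacuum_relations"
      by (simp add: Quotient_abs_rep[OF Quotient_heis_vac] flip: heis_vac.abs_eq_iff)
    from 0[OF this] show ?thesis
      by (simp add: \<psi>_def clinear_simps[OF uea_ext_clinear(2)])
  qed
  have surj: "\<exists>a. v = abs_heis_vac a" for v :: "'h heis_vac"
    by (metis Quotient_abs_rep[OF Quotient_heis_vac])
  show thesis
  proof
    show "clinear \<psi>"
    proof (rule clinearI)
      fix c and x y :: "'h heis_vac"
      obtain a b where "x = abs_heis_vac a" "y = abs_heis_vac b"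
        using surj by blast
      then show "\<psi> (x + y) = \<psi> x + \<psi> y" "\<psi> (c *\<^sub>C x) = c *\<^sub>C \<psi> x"
        by (simp_all add: plus_heis_vac.abs_eq scaleC_heis_vac.abs_eq abs uea_ext_simps)
    qed
    show "\<psi> vacuum = w"
      by (simp add: vacuum.abs_eq abs uea_ext_simps)
    fix x and v :: "'h heis_vac"
    obtain a where "v = abs_heis_vac a" using surj by blast
    then show "\<psi> (heis_act x v) = \<rho> x (\<psi> v)"
      by (simp add: heis_act_def uea_act.abs_eq abs uea_ext_simps)
  qed
qed

section \<open>The Fock representation\<close>

lemma form_diff_left: "form (x - y) z = form x z - form y z"
  using form_add_left[of "x - y" y z] by simp

lemma form_sum_left: "form (\<Sum>i\<in>I. f i) v = (\<Sum>i\<in>I. form (f i) v)"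
  by (induction I rule: infinite_finite_induct) (simp_all add: form_add_left)

lemma orthonormal_basis_expansion:
  assumes "orthonormal_basis B"
  shows "(\<Sum>b\<in>B. form u b *\<^sub>C b) = u"
proof -
  have fin: "finite B" and span: "complex_vector.span B = UNIV"
    and ortho: "\<And>x y. x \<in> B \<Longrightarrow> y \<in> B \<Longrightarrow> form x y = (if x = y then 1 else 0)"
    using assms by (auto simp: orthonormal_basis_def)
  have "u \<in> complex_vector.span B" using span by simp
  then show ?thesis
  proof (induction rule: complex_vector.span_induct_alt)
    case base
    then show ?case by simp
  next
    case (step c x y)
    have "(\<Sum>b\<in>B. form x b *\<^sub>C b) = (\<Sum>b\<in>B. if b = x then b else 0)"
      using step(1) by (intro sum.cong) (auto simp: ortho scaleC_one)
    then have "(\<Sum>b\<in>B. form x b *\<^sub>C b) = x"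
      using fin step(1) by simp
    moreover have "(\<Sum>b\<in>B. form (c *\<^sub>C x + y) b *\<^sub>C b) =
        c *\<^sub>C (\<Sum>b\<in>B. form x b *\<^sub>C b) + (\<Sum>b\<in>B. form y b *\<^sub>C b)"
      by (simp add: form_add_left form_scaleC_left scaleC_add_left sum.distrib scaleC_scaleC
          complex_vector.scale_sum_right)
    ultimately show ?case using step(2) by simp
  qed
qed

lemma orthonormal_basis_parseval:
  assumes "orthonormal_basis B"
  shows "(\<Sum>b\<in>B. form u b * form v b) = form u v"
proof -
  have "form u v = form (\<Sum>b\<in>B. form u b *\<^sub>C b) v"
    by (simp only: orthonormal_basis_expansion[OF assms])
  also have "\<dots> = (\<Sum>b\<in>B. form u b * form v b)"
    by (simp add: form_sum_left form_scaleC_left form_commute[of v])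
  finally show ?thesis by simp
qed

instantiation "fun" :: (type, complex_vector) complex_vector
begin

definition scaleC_fun :: "complex \<Rightarrow> ('a \<Rightarrow> 'b) \<Rightarrow> 'a \<Rightarrow> 'b"
  where "scaleC_fun c f = (\<lambda>x. c *\<^sub>C f x)"

instance
  by standard (simp_all add: scaleC_fun_def fun_eq_iff scaleC_add_right scaleC_add_left
      scaleC_scaleC scaleC_one)

end

text \<open>
  The Fock space is the space of functions on finite multisets of letters.  In the dual picture, where a
  multiset is a monomial, \<open>remove_op c\<close> is the transpose of the derivation that sends each letter \<open>z\<close>
  to the scalar \<open>c z\<close>.  It realises the creation operators, while the annihilation operators shift the
  argument by a letter; shifts commute with each other for trivial reasons.
\<close>
definition remove_op :: "('a \<Rightarrow> complex) \<Rightarrow> ('a multiset \<Rightarrow> complex) \<Rightarrow> 'a multiset \<Rightarrow> complex"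
  where "remove_op c F w = (\<Sum>z\<in>#w. c z * F (w - {#z#}))"

lemma remove_op_empty: "remove_op c F {#} = 0"
  by (simp add: remove_op_def)

text \<open>
  This is the canonical commutation relation: commuting the shift by \<open>a\<close> past \<open>remove_op c\<close> leaves
  the scalar \<open>c a\<close>.
\<close>
lemma remove_op_add_mset:
  "remove_op c F (add_mset a w) = c a * F w + remove_op c (\<lambda>v. F (add_mset a v)) w"
proof -
  have "(\<Sum>z\<in>#w. c z * F (add_mset a w - {#z#})) = (\<Sum>z\<in>#w. c z * F (add_mset a (w - {#z#})))"
    by (intro arg_cong[of _ _ sum_mset] image_mset_cong) simp
  then show ?thesis by (simp add: remove_op_def)
qed

lemma remove_op_linear:
  "remove_op c (\<lambda>v. F v + G v) w = remove_op c F w + remove_op c G w"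
  "remove_op c (\<lambda>v. k * F v) w = k * remove_op c F w"
  "remove_op c (\<lambda>v. \<Sum>i\<in>I. H i v) w = (\<Sum>i\<in>I. remove_op c (H i) w)"
proof -
  show add: "remove_op c (\<lambda>v. F v + G v) w = remove_op c F w + remove_op c G w" for F G
    by (simp add: remove_op_def algebra_simps sum_mset.distrib)
  show "remove_op c (\<lambda>v. k * F v) w = k * remove_op c F w"
    by (simp add: remove_op_def sum_mset_distrib_left mult.left_commute)
  show "remove_op c (\<lambda>v. \<Sum>i\<in>I. H i v) w = (\<Sum>i\<in>I. remove_op c (H i) w)"
    by (induction I rule: infinite_finite_induct) (simp_all add: add, simp_all add: remove_op_def)
qed

lemma remove_op_linear_left:
  "remove_op (\<lambda>z. c z + d z) F w = remove_op c F w + remove_op d F w"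
  "remove_op (\<lambda>z. k * c z) F w = k * remove_op c F w"
  by (simp_all add: remove_op_def algebra_simps sum_mset.distrib sum_mset_distrib_left)

lemma remove_op_commute: "remove_op c (remove_op d F) w = remove_op d (remove_op c F) w"
proof (induction w arbitrary: F)
  case empty
  then show ?case by (simp add: remove_op_empty)
next
  case (add a w)
  then show ?case by (simp add: remove_op_add_mset remove_op_linear)
qed

text \<open>
  A letter \<open>(b, k)\<close> with \<open>k > 0\<close> stands for \<open>b(-k)\<close>; letters with \<open>k \<le> 0\<close> also occur in the type,
  and the raising operators give them coefficient zero.
\<close>
definition fock_lower ::
  "'h::quadratic_space set \<Rightarrow> 'h heis \<Rightarrow> (('h \<times> int) multiset \<Rightarrow> complex) \<Rightarrow> ('h \<times> int) multiset \<Rightarrow> complex"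
  where "fock_lower B x F w = (\<Sum>m\<in>{m\<in>loop_support x. m > 0}. \<Sum>b\<in>B.
    of_int m * form (loop_coeff x m) b * F (add_mset (b, m) w))"

definition fock_raise ::
  "'h::quadratic_space heis \<Rightarrow> (('h \<times> int) multiset \<Rightarrow> complex) \<Rightarrow> ('h \<times> int) multiset \<Rightarrow> complex"
  where "fock_raise x = remove_op (\<lambda>(b, k). if k > 0 then form (loop_coeff x (- k)) b else 0)"

definition fock_rep ::
  "'h::quadratic_space set \<Rightarrow> 'h heis \<Rightarrow> (('h \<times> int) multiset \<Rightarrow> complex) \<Rightarrow> ('h \<times> int) multiset \<Rightarrow> complex"
  where "fock_rep B x F w = fock_lower B x F w + fock_raise x F w + central_part x * F w"

lemma fock_lower_superset:
  assumes "finite K" "loop_support x \<subseteq> K"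
  shows "fock_lower B x F w = (\<Sum>m\<in>K. \<Sum>b\<in>B.
    (if m > 0 then of_int m * form (loop_coeff x m) b * F (add_mset (b, m) w) else 0))"
proof -
  have "fock_lower B x F w = (\<Sum>m\<in>{m\<in>loop_support x. m > 0}. \<Sum>b\<in>B.
    (if m > 0 then of_int m * form (loop_coeff x m) b * F (add_mset (b, m) w) else 0))"
    unfolding fock_lower_def by (intro sum.cong) auto
  also have "\<dots> = (\<Sum>m\<in>K. \<Sum>b\<in>B.
    (if m > 0 then of_int m * form (loop_coeff x m) b * F (add_mset (b, m) w) else 0))"
    using assms by (intro sum.mono_neutral_left) (auto simp: in_keys_iff intro!: sum.neutral split: if_splits)
  finally show ?thesis .
qed

lemma fock_lower_commute: "fock_lower B x (fock_lower B y F) w = fock_lower B y (fock_lower B x F) w"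
proof -
  define M N where "M = {m\<in>loop_support x. m > 0} \<times> B" and "N = {m\<in>loop_support y. m > 0} \<times> B"
  have pair: "fock_lower B x F w = (\<Sum>(m,b)\<in>{m\<in>loop_support x. m > 0} \<times> B.
      of_int m * form (loop_coeff x m) b * F (add_mset (b, m) w))" for x F w
    by (simp add: fock_lower_def sum.cartesian_product)
  show ?thesis
    unfolding pair M_def[symmetric] N_def[symmetric] case_prod_unfold sum_distrib_left
    by (subst sum.swap) (simp add: add_mset_commute mult_ac)
qed

text \<open>
  The only noncommuting pairs are lowering against raising operators, and there the scalars
  \<open>\<langle>x\<^sub>m,b\<rangle>\<langle>b,y\<^bsub>-m\<^esub>\<rangle>\<close> add up over the orthonormal basis to \<open>\<langle>x\<^sub>m,y\<^bsub>-m\<^esub>\<rangle>\<close>.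
\<close>
lemma fock_lower_raise:
  assumes B: "orthonormal_basis B"
  shows "fock_lower B x (fock_raise y F) w = fock_raise y (fock_lower B x F) w +
    (\<Sum>m\<in>{m\<in>loop_support x. m > 0}. of_int m * form (loop_coeff x m) (loop_coeff y (- m))) * F w"
proof -
  define c where "c = (\<lambda>(b, k). if k > 0 then form (loop_coeff y (- k)) b else 0)"
  let ?M = "{m\<in>loop_support x. m > 0}"
  have "fock_lower B x (fock_raise y F) w = (\<Sum>m\<in>?M. \<Sum>b\<in>B. of_int m * form (loop_coeff x m) b *
      (c (b, m) * F w + remove_op c (\<lambda>v. F (add_mset (b, m) v)) w))"
    by (simp add: fock_lower_def fock_raise_def remove_op_add_mset c_def)
  also have "\<dots> = (\<Sum>m\<in>?M. \<Sum>b\<in>B. of_int m * form (loop_coeff x m) b * c (b, m) * F w) +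
      (\<Sum>m\<in>?M. \<Sum>b\<in>B. of_int m * form (loop_coeff x m) b * remove_op c (\<lambda>v. F (add_mset (b, m) v)) w)"
    by (simp add: algebra_simps sum.distrib)
  also have "(\<Sum>m\<in>?M. \<Sum>b\<in>B. of_int m * form (loop_coeff x m) b * remove_op c (\<lambda>v. F (add_mset (b, m) v)) w)
      = fock_raise y (fock_lower B x F) w"
    by (simp add: fock_lower_def[abs_def] fock_raise_def c_def remove_op_linear)
  also have "(\<Sum>m\<in>?M. \<Sum>b\<in>B. of_int m * form (loop_coeff x m) b * c (b, m) * F w)
      = (\<Sum>m\<in>?M. of_int m * (\<Sum>b\<in>B. form (loop_coeff x m) b * form (loop_coeff y (- m)) b) * F w)"
    by (intro sum.cong refl) (simp add: c_def sum_distrib_left sum_distrib_right mult_ac)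
  also have "\<dots> = (\<Sum>m\<in>?M. of_int m * form (loop_coeff x m) (loop_coeff y (- m))) * F w"
    by (simp add: orthonormal_basis_parseval[OF B] sum_distrib_right)
  finally show ?thesis by simp
qed

text \<open>
  The cocycle, split by the sign of \<open>m\<close> to match the commutators of lowering with raising operators:
  the negative half is reindexed by \<open>m \<mapsto> -m\<close>.
\<close>
lemma central_part_bracket:
  "central_part (bracket x y) =
    (\<Sum>m\<in>{m\<in>loop_support x. m > 0}. of_int m * form (loop_coeff x m) (loop_coeff y (- m))) -
    (\<Sum>m\<in>{m\<in>loop_support y. m > 0}. of_int m * form (loop_coeff y m) (loop_coeff x (- m)))"
proof -
  define K where "K = loop_support x \<union> loop_support y"
  define f where "f m = of_int m * form (loop_coeff x m) (loop_coeff y (- m))" for m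
  let ?J = "K \<union> uminus ` K"
  have fin: "finite ?J" by (simp add: K_def)
  then have fin_pos: "finite {m\<in>?J. m > 0}" by simp
  have "central_part (bracket x y) = sum f ?J"
    by (subst bracket_heis_superset[OF fin]) (auto simp: K_def f_def)
  also have "?J = {m\<in>?J. m > 0} \<union> {m\<in>?J. m < 0} \<union> {m\<in>?J. m = 0}" by auto
  also have "sum f \<dots> = sum f {m\<in>?J. m > 0} + sum f {m\<in>?J. m < 0} + sum f {m\<in>?J. m = 0}"
    using fin by (subst sum.union_disjoint; auto)+
  also have "sum f {m\<in>?J. m = 0} = 0"
    by (intro sum.neutral) (auto simp: f_def)
  also have "sum f {m\<in>?J. m > 0} = sum f {m\<in>loop_support x. m > 0}"
    by (intro sum.mono_neutral_right fin_pos) (auto simp: K_def f_def in_keys_iff)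
  also have "sum f {m\<in>?J. m < 0} = sum (\<lambda>m. f (- m)) {m\<in>?J. m > 0}"
    by (rule sum.reindex_bij_witness[where i = uminus and j = uminus]) auto
  also have "\<dots> = (\<Sum>m\<in>{m\<in>loop_support y. m > 0}. f (- m))"
    by (intro sum.mono_neutral_right fin_pos) (auto simp: K_def f_def in_keys_iff)
  also have "\<dots> = - (\<Sum>m\<in>{m\<in>loop_support y. m > 0}. of_int m * form (loop_coeff y m) (loop_coeff x (- m)))"
    by (simp add: f_def form_commute sum_negf)
  finally show ?thesis by (simp add: f_def)
qed

lemma lie_representation_fock_rep:
  assumes B: "orthonormal_basis B"
  shows "lie_representation (fock_rep B)"
proof (rule lie_representation.intro)
  fix x y :: "'a heis" and c and F :: "('a \<times> int) multiset \<Rightarrow> complex"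
  show "clinear (fock_rep B x)"
    by (intro clinearI)
      (simp_all add: fun_eq_iff fock_rep_def fock_lower_def fock_raise_def remove_op_linear
        plus_fun_def scaleC_fun_def scaleC_complex_def algebra_simps sum.distrib sum_distrib_left)
  define K where "K = loop_support x \<union> loop_support y \<union> loop_support (x + y) \<union> loop_support (c *\<^sub>C x)"
  have fin: "finite K"
    by (simp add: K_def)
  have K: "loop_support x \<subseteq> K" "loop_support y \<subseteq> K"
    "loop_support (x + y) \<subseteq> K" "loop_support (c *\<^sub>C x) \<subseteq> K"
    by (auto simp: K_def)
  have raise_add: "fock_raise (x + y) F w = fock_raise x F w + fock_raise y F w" for w
    unfolding fock_raise_def remove_op_linear_left(1)[symmetric]
    by (rule arg_cong[of _ _ "\<lambda>f. remove_op f F w"])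
      (auto simp: fun_eq_iff plus_heis_def lookup_add form_add_left)
  have raise_scale: "fock_raise (c *\<^sub>C x) F w = c * fock_raise x F w" for w
    unfolding fock_raise_def remove_op_linear_left(2)[symmetric]
    by (rule arg_cong[of _ _ "\<lambda>f. remove_op f F w"])
      (auto simp: fun_eq_iff scaleC_heis_def scaleC_poly_mapping.rep_eq form_scaleC_left)
  have lower_add: "fock_lower B (x + y) F w = fock_lower B x F w + fock_lower B y F w" for w
    unfolding K[THEN fock_lower_superset[OF fin]] sum.distrib[symmetric]
    by (intro sum.cong refl) (simp add: plus_heis_def lookup_add form_add_left algebra_simps)
  have lower_scale: "fock_lower B (c *\<^sub>C x) F w = c * fock_lower B x F w" for w
    unfolding K[THEN fock_lower_superset[OF fin]] sum_distrib_left
    by (intro sum.cong refl)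
      (simp add: scaleC_heis_def scaleC_poly_mapping.rep_eq form_scaleC_left algebra_simps)
  show "fock_rep B (x + y) F = fock_rep B x F + fock_rep B y F"
    by (rule ext)
      (simp add: fock_rep_def raise_add lower_add, simp add: plus_heis_def algebra_simps)
  show "fock_rep B (c *\<^sub>C x) F = c *\<^sub>C fock_rep B x F"
    by (rule ext) (simp add: fock_rep_def raise_scale lower_scale,
        simp add: fock_rep_def scaleC_heis_def scaleC_fun_def scaleC_complex_def algebra_simps)
  have "fock_rep B (bracket x y) F w = central_part (bracket x y) * F w" for w
    by (simp add: fock_rep_def fock_lower_def fock_raise_def bracket_heis_def remove_op_def case_prod_unfold
        cong: if_cong)
  moreover have "fock_rep B x (fock_rep B y F) w - fock_rep B y (fock_rep B x F) w =
      central_part (bracket x y) * F w" for w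
  proof -
    have lin: "fock_lower B x (\<lambda>w. F w + G w + k * H w) w
        = fock_lower B x F w + fock_lower B x G w + k * fock_lower B x H w"
      "fock_raise x (\<lambda>w. F w + G w + k * H w) w
        = fock_raise x F w + fock_raise x G w + k * fock_raise x H w" for x F G H k w
      by (simp_all add: fock_lower_def fock_raise_def remove_op_linear algebra_simps sum.distrib
          sum_distrib_left)
    have "fock_raise x (fock_raise y F) w = fock_raise y (fock_raise x F) w"
      unfolding fock_raise_def by (rule remove_op_commute)
    then show ?thesis
      unfolding fock_rep_def[abs_def] lin fock_lower_raise[OF B]
      by (simp add: fock_lower_commute[of B x y] central_part_bracket algebra_simps)
  qed
  ultimately show "fock_rep B (bracket x y) F = fock_rep B x (fock_rep B y F) - fock_rep B y (fock_rep B x F)"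
    by (simp add: fun_eq_iff)
qed

text \<open>
  The indicator function of the empty multiset is a vacuum in the Fock space: shifting it by a letter
  gives zero, and the raising part of a nonnegative element is zero.
\<close>
lemma vacuum_nonzero:
  fixes B :: "'h::quadratic_space set"
  assumes "orthonormal_basis B"
  shows "(vacuum :: 'h heis_vac) \<noteq> 0"
proof
  \<comment> \<open>The vacuum of the Fock space, the monomial of degree zero.\<close>
  define F0 :: "('h \<times> int) multiset \<Rightarrow> complex" where "F0 w = (if w = {#} then 1 else 0)" for w
  assume 0: "(vacuum :: 'h heis_vac) = 0"
  have F0: "fock_rep B x F0 = central_part x *\<^sub>C F0" if "x \<in> heis_nonneg" for x
  proof -
    have "form (loop_coeff x (- k)) b = 0" if "k > 0" for k b
      using \<open>x \<in> heis_nonneg\<close> that by (simp add: heis_nonneg_def)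
    then have "fock_raise x F0 w = 0" for w
      unfolding fock_raise_def remove_op_def case_prod_unfold
      by (simp cong: if_cong)
    then show ?thesis
      by (simp add: fun_eq_iff fock_rep_def fock_lower_def F0_def scaleC_fun_def scaleC_complex_def)
  qed
  obtain \<psi> :: "'h heis_vac \<Rightarrow> _" where "clinear \<psi>" "\<psi> vacuum = F0"
    using heis_vac_universal[OF lie_representation_fock_rep[OF assms] F0] by metis
  then have "F0 {#} = 0" using 0 clinear_simps(3) by (metis zero_fun_apply)
  then show False by (simp add: F0_def)
qed

section \<open>Modes and the standard gradation\<close>

lemma heis_act_simps:
  "heis_act (x + y) v = heis_act x v + heis_act y v"
  "heis_act (c *\<^sub>C x) v = c *\<^sub>C heis_act x v"
  "heis_act x (heis_act y v) = heis_act y (heis_act x v) + heis_act (bracket x y) v"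
proof -
  show "heis_act x (heis_act y v) = heis_act y (heis_act x v) + heis_act (bracket x y) v"
    unfolding heis_act_def uea_act_mult[symmetric] uea_act_add[symmetric]
    by (simp only: uea_of_bracket[of x y])
qed (simp_all add: heis_act_def uea_of_add uea_of_scaleC uea_act_add uea_act_scaleC)

lemma heis_act_clinear: "clinear (heis_act x)"
  unfolding heis_act_def by (rule uea_act_clinear)

lemma heis_act_zero: "heis_act 0 v = 0"
  using heis_act_simps(2)[of 0 0 v] by simp

lemma heis_act_central: "heis_act (Heis 0 c) v = c *\<^sub>C v"
proof (induction v rule: heis_vac_induct)
  case (5 x v)
  have "bracket (Heis 0 c) x = 0"
    by (simp add: bracket_heis_def zero_heis_def)
  with 5 show ?case
    by (simp add: heis_act_simps(3)[of "Heis 0 c" x] heis_act_zero clinear_simps[OF heis_act_clinear])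
qed (simp_all add: clinear_simps[OF heis_act_clinear] heis_act_vacuum heis_nonneg_def
    scaleC_add_right scaleC_scaleC mult.commute)

lemma bracket_loop:
  "bracket (loop u m) (loop v n) = Heis 0 (if m + n = 0 then of_int m * form u v else 0)"
  by (subst bracket_heis_superset[of "{m}"]) (auto simp: loop_def lookup_single when_def)

lemma mode_clinear: "clinear (mode u n)"
  by (simp add: mode_eq_heis_act heis_act_clinear)

lemma mode_add: "mode (u + u') n v = mode u n v + mode u' n v"
proof -
  have "loop (u + u') n = loop u n + loop u' n"
    by (simp add: loop_def plus_heis_def single_add)
  then show ?thesis by (simp add: mode_eq_heis_act heis_act_simps)
qed

lemma mode_scaleC: "mode (c *\<^sub>C u) n v = c *\<^sub>C mode u n v"
proof -
  have "Poly_Mapping.single n (c *\<^sub>C u) = c *\<^sub>C Poly_Mapping.single n u"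
    by (rule poly_mapping_eqI) (simp add: lookup_single scaleC_poly_mapping.rep_eq when_def)
  then have "loop (c *\<^sub>C u) n = c *\<^sub>C loop u n"
    by (simp add: loop_def scaleC_heis_def)
  then show ?thesis by (simp add: mode_eq_heis_act heis_act_simps)
qed

lemma mode_clinear_left: "clinear (\<lambda>u. mode u n v)"
  by (intro clinearI mode_add mode_scaleC)

lemma mode_commute:
  "mode u m (mode v n w) = mode v n (mode u m w) + (if m + n = 0 then of_int m * form u v else 0) *\<^sub>C w"
  by (simp only: mode_eq_heis_act heis_act_simps(3)[of "loop u m"] bracket_loop heis_act_central)

lemma mode_vacuum:
  assumes "n \<ge> 0"
  shows "mode u n vacuum = 0"
  using assms by (simp add: mode_eq_heis_act heis_act_vacuum heis_nonneg_def loop_def lookup_single)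

lemma mode_induct:
  assumes vac: "P vacuum" and add: "\<And>v w. P v \<Longrightarrow> P w \<Longrightarrow> P (v + w)"
    and scale: "\<And>c v. P v \<Longrightarrow> P (c *\<^sub>C v)" and mode: "\<And>u n v. P v \<Longrightarrow> P (mode u n v)"
  shows "P v"
proof (induction v rule: heis_vac_induct)
  case 1
  then show ?case using scale[OF vac, of 0] by simp
next
  case (5 x v)
  have "P (heis_act (Heis p c) v)" for p c
  proof (induction p rule: poly_mapping_induct)
    case 1
    then show ?case by (simp add: heis_act_central scale 5)
  next
    case (2 k u p)
    have "Heis (Poly_Mapping.single k u + p) c = loop u k + Heis p c"
      by (simp add: loop_def plus_heis_def)
    with 2 show ?case by (simp add: heis_act_simps add mode 5 flip: mode_eq_heis_act)
  qed
  then show ?case by (metis heis.exhaust)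
qed (fact assms)+

text \<open>The operators \<open>u(0)\<close> are central and annihilate \<open>\<one>\<close>.\<close>
lemma mode_zero: "mode u 0 v = 0"
  by (induction v rule: mode_induct)
    (simp_all add: mode_vacuum clinear_simps[OF mode_clinear] mode_commute[of u 0])

definition fock_monomial :: "('h::quadratic_space \<times> nat) list \<Rightarrow> 'h heis_vac"
  where "fock_monomial uks = foldr (\<lambda>(u, k). mode u (- int k)) uks vacuum"

lemma fock_monomial_simps:
  "fock_monomial [] = vacuum"
  "fock_monomial ((u, k) # uks) = mode u (- int k) (fock_monomial uks)"
  by (simp_all add: fock_monomial_def)

definition creation_word :: "('h \<times> nat) list \<Rightarrow> bool"
  where "creation_word uks \<longleftrightarrow> (\<forall>(u, k)\<in>set uks. k \<ge> 1)"

lemma creation_word_simps: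
  "creation_word []"
  "creation_word ((u, k) # uks) \<longleftrightarrow> k \<ge> 1 \<and> creation_word uks"
  by (simp_all add: creation_word_def)

lemma standard_grade_altdef: "standard_grade n = complex_vector.span
    {fock_monomial uks | uks. creation_word uks \<and> sum_list (map snd uks) = n}"
  by (simp add: standard_grade_def fock_monomial_def creation_word_def)

lemma subspace_standard_grade: "complex_vector.subspace (standard_grade n)"
  unfolding standard_grade_def by (rule complex_vector.subspace_span)

lemma fock_monomial_in_standard_grade:
  assumes "creation_word uks"
  shows "fock_monomial uks \<in> standard_grade (sum_list (map snd uks))"
  unfolding standard_grade_altdef using assms by (intro complex_vector.span_base) blast

text \<open>
  The spanning half of Poincare--Birkhoff--Witt: an operator \<open>u(n)\<close> with \<open>n \<ge> 0\<close> is moved to the right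
  until it reaches \<open>\<one>\<close>, and every commutator met on the way is a scalar.
\<close>
lemma fock_monomials_span:
  "complex_vector.span {fock_monomial uks | uks. creation_word uks} = UNIV"
  (is "complex_vector.span ?W = UNIV")
proof -
  have lower: "mode u (- int k) v \<in> complex_vector.span ?W"
    if "v \<in> complex_vector.span ?W" "k \<ge> 1" for u k v
    using that(1)
  proof (rule span_mapI, goal_cases)
    case (4 x)
    then obtain uks where "x = fock_monomial uks" "creation_word uks"
      by blast
    with that(2) show ?case
      by (intro complex_vector.span_base CollectI exI[of _ "(u, k) # uks"])
      (auto simp: fock_monomial_simps creation_word_simps)
  qed (simp_all add: clinear_simps[OF mode_clinear])
  have raise: "mode u n (fock_monomial uks) \<in> complex_vector.span ?W"
    if "n \<ge> 0" "creation_word uks" for u n uks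
    using that
  proof (induction uks)
    case Nil
    then show ?case by (simp add: fock_monomial_simps mode_vacuum complex_vector.span_zero)
  next
    case (Cons vk uks)
    obtain v k where vk: "vk = (v, k)" by force
    have "fock_monomial uks \<in> complex_vector.span ?W"
      using Cons by (intro complex_vector.span_base) (auto simp: vk creation_word_simps)
    with Cons show ?case
      by (auto simp: vk fock_monomial_simps creation_word_simps mode_commute[of u n]
          intro!: complex_vector.span_add complex_vector.span_scale lower)
  qed
  have "mode u n v \<in> complex_vector.span ?W" if "v \<in> complex_vector.span ?W" for u n v
  proof (cases "n \<ge> 0")
    case True
    from that show ?thesis
      by (rule span_mapI) (use True raise in \<open>auto simp: clinear_simps[OF mode_clinear]\<close>)
  next
    case False
    then show ?thesis using lower[OF that, of "nat (- n)" u] by simp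
  qed
  moreover have "vacuum \<in> complex_vector.span ?W"
    by (intro complex_vector.span_base CollectI exI[of _ "[]"]) (simp add: fock_monomial_simps creation_word_simps)
  ultimately have "v \<in> complex_vector.span ?W" for v
    by (induction v rule: mode_induct) (auto intro: complex_vector.span_add complex_vector.span_scale)
  then show ?thesis by blast
qed

lemma standard_grades_span: "complex_vector.span (\<Union>n. standard_grade n) = UNIV"
proof -
  have "{fock_monomial uks | uks. creation_word uks} \<subseteq> (\<Union>n. standard_grade n)"
    using fock_monomial_in_standard_grade by blast
  from complex_vector.span_mono[OF this] show ?thesis
    by (simp add: fock_monomials_span top.extremum_unique)
qed

lemma standard_grade_1: "standard_grade 1 = range (\<lambda>u. mode u (- 1) vacuum)"
proof
  show "range (\<lambda>u. mode u (- 1) vacuum) \<subseteq> standard_grade 1"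
    using fock_monomial_in_standard_grade[of "[(u, 1)]" for u] by (auto simp: fock_monomial_simps creation_word_simps)
  show "standard_grade 1 \<subseteq> range (\<lambda>u. mode u (- 1) vacuum)"
  proof
    fix v
    assume "v \<in> standard_grade 1"
    then show "v \<in> range (\<lambda>u. mode u (- 1) vacuum)"
      unfolding standard_grade_altdef
    proof (induction rule: complex_vector.span_induct_alt)
      case base
      then show ?case using clinear_simps(3)[OF mode_clinear_left] by (metis rangeI)
    next
      case (step c x y)
      then obtain uks where x: "x = fock_monomial uks" "creation_word uks" "sum_list (map snd uks) = 1"
        by blast
      have "\<exists>u. uks = [(u, 1)]"
        using x(2,3) by (cases uks; cases "tl uks") (auto simp: creation_word_def)
      then obtain u w where "x = mode u (- 1) vacuum" "y = mode w (- 1) vacuum"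
        using x(1) step(2) by (auto simp: fock_monomial_simps)
      then have "c *\<^sub>C x + y = mode (c *\<^sub>C u + w) (- 1) vacuum"
        by (simp add: clinear_simps[OF mode_clinear_left])
      then show ?case by blast
    qed
  qed
qed

text \<open>
  The operator \<open>\<Sum> b(-1)b(1)\<close> counts the factors \<open>u(-1)\<close> of a monomial: it multiplies \<open>u(-1)w(-1)\<one>\<close> by
  two and annihilates \<open>h(-2)\<one>\<close>.  These two kinds of monomials span degree two.
\<close>
lemma standard_grade_2_cases:
  fixes v :: "'h::quadratic_space heis_vac"
  assumes "v \<in> standard_grade 2" and B: "orthonormal_basis (B :: 'h set)"
  shows "\<exists>h. v = (1 / 2) *\<^sub>C (\<Sum>b\<in>B. mode b (- 1) (mode b 1 v)) + mode h (- 2) vacuum"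
proof -
  define E where "E v = (1 / 2) *\<^sub>C (\<Sum>b\<in>B. mode b (- 1) (mode b 1 v))" for v :: "'h heis_vac"
  have E: "E (c *\<^sub>C x + y) = c *\<^sub>C E x + E y" for c x y
    by (simp add: E_def clinear_simps[OF mode_clinear] scaleC_add_right scaleC_scaleC sum.distrib
        complex_vector.scale_sum_right mult.commute)
  have "\<exists>h. v = E v + mode h (- 2) vacuum"
    using assms(1) unfolding standard_grade_altdef
  proof (induction rule: complex_vector.span_induct_alt)
    case base
    have "E 0 = 0" by (simp add: E_def clinear_simps[OF mode_clinear])
    then show ?case by (intro exI[of _ 0]) (simp add: clinear_simps[OF mode_clinear_left])
  next
    case (step c x y)
    then obtain uks h where x: "x = fock_monomial uks" "creation_word uks" "sum_list (map snd uks) = 2"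
      and y: "y = E y + mode h (- 2) vacuum"
      by blast
    have "(\<exists>u. uks = [(u, 2)]) \<or> (\<exists>u v. uks = [(u, 1), (v, 1)])"
      using x(2,3) by (cases uks; cases "tl uks"; cases "tl (tl uks)") (auto simp: creation_word_def)
    then have "\<exists>h. x = E x + mode h (- 2) vacuum"
    proof (elim disjE exE)
      fix u
      assume "uks = [(u, 2)]"
      then have *: "x = mode u (- 2) vacuum"
        by (simp add: x fock_monomial_simps)
      then have "E x = 0"
        by (simp add: E_def mode_commute[of _ 1] mode_vacuum clinear_simps[OF mode_clinear])
      with * show ?thesis by auto
    next
      fix u w
      assume "uks = [(u, 1), (w, 1)]"
      then have *: "x = mode u (- 1) (mode w (- 1) vacuum)"
        by (simp add: x fock_monomial_simps)
      have "mode b 1 x = form w b *\<^sub>C mode u (- 1) vacuum + form u b *\<^sub>C mode w (- 1) vacuum" for b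
        by (simp add: * mode_commute[of _ 1] mode_vacuum clinear_simps[OF mode_clinear] form_commute)
      then have "(\<Sum>b\<in>B. mode b (- 1) (mode b 1 x)) =
          mode (\<Sum>b\<in>B. form w b *\<^sub>C b) (- 1) (mode u (- 1) vacuum) +
          mode (\<Sum>b\<in>B. form u b *\<^sub>C b) (- 1) (mode w (- 1) vacuum)"
        by (simp add: clinear_simps[OF mode_clinear] clinear_simps[OF mode_clinear_left] sum.distrib)
      also have "\<dots> = x + x"
        by (simp add: orthonormal_basis_expansion[OF B] * mode_commute[of w "- 1" u "- 1"])
      finally have "E x = (1 / 2) *\<^sub>C (x + x)" by (simp add: E_def)
      also have "\<dots> = x"
        by (simp add: scaleC_add_right scaleC_one flip: scaleC_add_left)
      finally show ?thesis
        by (intro exI[of _ 0]) (simp add: clinear_simps[OF mode_clinear_left])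
    qed
    then obtain h' where h': "x = E x + mode h' (- 2) vacuum" by blast
    have "c *\<^sub>C x + y = c *\<^sub>C (E x + mode h' (- 2) vacuum) + (E y + mode h (- 2) vacuum)"
      using h' y by metis
    also have "\<dots> = E (c *\<^sub>C x + y) + mode (c *\<^sub>C h' + h) (- 2) vacuum"
      by (simp add: E clinear_simps[OF mode_clinear_left] scaleC_add_right)
    finally show ?case by blast
  qed
  then show ?thesis by (simp add: E_def)
qed

lemma mode_omega:
  fixes h :: "'h::quadratic_space"
  assumes B: "orthonormal_basis B" and "m \<ge> 0"
  shows "mode u m (omega B h) = (if m = 1 then mode u (- 1) vacuum
    else if m = 2 then (2 * form u h) *\<^sub>C vacuum else 0)"
proof -
  have "mode u 1 (mode b (- 1) (mode b (- 1) vacuum)) = (2 * form u b) *\<^sub>C mode b (- 1) vacuum" for b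
    by (simp add: mode_commute[of u 1] mode_vacuum clinear_simps[OF mode_clinear] flip: scaleC_add_left)
  then have "mode u 1 (omega B h) = (\<Sum>b\<in>B. form u b *\<^sub>C mode b (- 1) vacuum)"
    by (simp add: omega_def clinear_simps[OF mode_clinear] complex_vector.scale_sum_right scaleC_scaleC
        mode_commute[of u 1 h] mode_vacuum)
  also have "\<dots> = mode (\<Sum>b\<in>B. form u b *\<^sub>C b) (- 1) vacuum"
    by (simp add: clinear_simps[OF mode_clinear_left])
  finally have "mode u 1 (omega B h) = mode u (- 1) vacuum"
    by (simp only: orthonormal_basis_expansion[OF B])
  with assms(2) show ?thesis
    by (cases "m = 1")
      (auto simp: omega_def clinear_simps[OF mode_clinear] mode_commute[of u m] mode_vacuum)
qed

lemma omega_in_standard_grade_2: "omega B h \<in> standard_grade 2"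
proof -
  have "mode b (- 1) (mode b (- 1) vacuum) \<in> standard_grade 2" for b :: 'a
    using fock_monomial_in_standard_grade[of "[(b, 1), (b, 1)]"]
    by (simp add: fock_monomial_simps creation_word_simps numeral_2_eq_2)
  moreover have "mode h (- 2) vacuum \<in> standard_grade 2"
    using fock_monomial_in_standard_grade[of "[(h, 2)]"]
    by (simp add: fock_monomial_simps creation_word_simps)
  ultimately show ?thesis
    unfolding omega_def
    by (intro complex_vector.subspace_add complex_vector.subspace_scale complex_vector.subspace_sum
        subspace_standard_grade)
qed

text \<open>
  For such \<open>v\<close> the expression \<open>\<Sum> b(-1)b(1)v\<close> of the degree-two normal form becomes
  \<open>\<Sum> b(-1)b(-1)\<one>\<close>.
\<close>
lemma omega_eqI:
  assumes B: "orthonormal_basis B" and "v \<in> standard_grade 2"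
    and "\<And>u. mode u 1 v = mode u (- 1) vacuum"
  obtains h where "v = omega B h"
  using standard_grade_2_cases[OF assms(2) B] assms(3) by (auto simp: omega_def)

text \<open>Apply \<open>x(1)\<close>, which turns \<open>u(-1)\<one>\<close> into \<open>\<langle>x,u\<rangle>\<one>\<close>.\<close>
lemma mode_vacuum_inject:
  fixes u v :: "'h::quadratic_space" and B :: "'h set"
  assumes B: "orthonormal_basis B" and "mode u (- 1) vacuum = mode v (- 1) vacuum"
  shows "u = v"
proof -
  have "form (u - v) x = 0" for x
  proof -
    have "mode x 1 (mode (u - v) (- 1) vacuum) = mode x 1 0"
      by (simp add: clinear_simps[OF mode_clinear_left] assms(2))
    then have "form x (u - v) *\<^sub>C vacuum = (0 :: 'h heis_vac)"
      by (simp add: mode_commute[of x 1] mode_vacuum clinear_simps[OF mode_clinear])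
    then show ?thesis
      using vacuum_nonzero[OF B] by (simp add: form_commute)
  qed
  then show ?thesis using form_nondegenerate[of "u - v"] by simp
qed

text \<open>
  By multilinearity the monomials with all letters in \<open>B \<times> {1..n}\<close> suffice, and the degree bounds their
  length by \<open>n\<close>.
\<close>
lemma finite_dim_standard_grade:
  fixes B :: "'h::quadratic_space set"
  assumes B: "orthonormal_basis B"
  shows "\<exists>A. finite A \<and> standard_grade n \<subseteq> complex_vector.span (A :: 'h heis_vac set)"
proof -
  define L where "L n = {bks :: ('h \<times> nat) list. set bks \<subseteq> B \<times> {1..n} \<and> length bks \<le> n}" for n
  have fin: "finite B" and span: "complex_vector.span B = UNIV"
    using B by (auto simp: orthonormal_basis_def)
  have "finite (L n)"
    unfolding L_def using fin by (intro finite_lists_length_le) auto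
  moreover have "fock_monomial uks \<in> complex_vector.span (fock_monomial ` L (sum_list (map snd uks)))"
    if "creation_word uks" for uks
    using that
  proof (induction uks)
    case Nil
    then show ?case by (auto simp: L_def fock_monomial_simps intro!: complex_vector.span_base)
  next
    case (Cons uk uks)
    obtain u k where uk: "uk = (u, k)" by force
    let ?n = "sum_list (map snd uks)"
    have "fock_monomial uks \<in> complex_vector.span (fock_monomial ` L ?n)"
      using Cons by (simp add: uk creation_word_simps)
    then have "mode u (- int k) (fock_monomial uks) \<in> complex_vector.span (fock_monomial ` L (k + ?n))"
    proof (rule span_mapI, goal_cases)
      case (4 x)
      then obtain bks where bks: "x = fock_monomial bks" "bks \<in> L ?n" by blast
      have "u \<in> complex_vector.span B" using span by simp
      then show ?case
      proof (rule span_mapI[where f = "\<lambda>u. mode u (- int k) x"], goal_cases)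
        case (4 b)
        then have "(b, k) # bks \<in> L (k + ?n)"
          using bks(2) Cons(2) by (auto simp: L_def uk creation_word_simps)
        then show ?case
          by (intro complex_vector.span_base) (metis bks(1) fock_monomial_simps(2) imageI)
      qed (simp_all add: clinear_simps[OF mode_clinear_left])
    qed (simp_all add: clinear_simps[OF mode_clinear])
    then show ?case by (simp add: uk fock_monomial_simps)
  qed
  then have "standard_grade n \<subseteq> complex_vector.span (fock_monomial ` L n)"
    unfolding standard_grade_altdef by (intro complex_vector.span_minimal) auto
  ultimately show ?thesis by blast
qed

section \<open>Consequences of the Jacobi identity\<close>

lemma Sum_any_expand:
  assumes "\<And>i. i \<ge> N \<Longrightarrow> f i = 0"
  shows "Sum_any f = (\<Sum>i<(N::nat). f i)"
  by (rule Sum_any.expand_superset) (use assms not_le in auto)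

context vertex_algebra
begin

lemma Y_zero: "Y 0 n v = 0" "Y u n 0 = 0"
  using clinear_simps(3)[OF Y_linear_left] clinear_simps(3)[OF Y_linear_right] by auto

text \<open>The case \<open>l = 0\<close> of the Jacobi identity.\<close>
lemma commutator_formula:
  "Y u m (Y v n w) - Y v n (Y u m w)
    = Sum_any (\<lambda>i. (of_int m gchoose i) *\<^sub>C Y (Y u (int i) v) (m + n - int i) w)"
proof -
  have "Sum_any (\<lambda>i. ((- 1) ^ i * (of_int 0 gchoose i)) *\<^sub>C
          (Y u (m + 0 - int i) (Y v (n + int i) w)
            - ((- 1) powi 0) *\<^sub>C Y v (n + 0 - int i) (Y u (m + int i) w)))
      = Y u m (Y v n w) - Y v n (Y u m w)"
    by (subst Sum_any_expand[where N = 1]) (auto simp: gbinomial_0_left scaleC_one)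
  then show ?thesis
    using jacobi[of 0 u m v n w] by simp
qed

text \<open>The case \<open>m = 0\<close> of the Jacobi identity.\<close>
lemma iterate_formula:
  "Y (Y u l v) n w = Sum_any (\<lambda>i. ((- 1) ^ i * (of_int l gchoose i)) *\<^sub>C
     (Y u (l - int i) (Y v (n + int i) w) - ((- 1) powi l) *\<^sub>C Y v (n + l - int i) (Y u (int i) w)))"
proof -
  have "Sum_any (\<lambda>i. (of_int 0 gchoose i) *\<^sub>C Y (Y u (l + int i) v) (0 + n - int i) w) = Y (Y u l v) n w"
    by (subst Sum_any_expand[where N = 1]) (auto simp: gbinomial_0_left scaleC_one)
  then show ?thesis
    using jacobi[of l u 0 v n w] by simp
qed

text \<open>
  The map \<open>v \<mapsto> v\<^bsub>-2\<^esub>\<one>\<close> is the translation operator of the vertex algebra.  In the iterate formula every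
  term contains a mode of the vacuum, so at most one term survives; the sign of \<open>n\<close> decides which of
  the two summands it comes from.
\<close>
lemma translation_derivative: "Y (Y v (- 2) vac) n w = - (of_int n *\<^sub>C Y v (n - 1) w)"
proof -
  have coeff: "(- 1) ^ i * (of_int (- 2) gchoose i) = (of_nat (Suc i) :: complex)" for i
  proof -
    have "(of_int (- 2) gchoose i :: complex) = (- 1) ^ i * (of_nat (Suc i) gchoose i)"
      using gbinomial_minus[of "2 :: complex" i] by (simp add: algebra_simps)
    also have "(of_nat (Suc i) gchoose i :: complex) = of_nat (Suc i)"
      unfolding binomial_gbinomial[symmetric] by simp
    finally show ?thesis by (simp flip: power_mult_distrib mult.assoc)
  qed
  define f where "f i = of_nat (Suc i) *\<^sub>C
     (Y v (- 2 - int i) (Y vac (n + int i) w) - Y vac (n - 2 - int i) (Y v (int i) w))" for i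
  have *: "Y (Y v (- 2) vac) n w = Sum_any f"
    unfolding iterate_formula[of v "- 2" vac n w] coeff f_def by (simp add: scaleC_one)
  \<comment> \<open>The two summands ask for index \<open>i = - 1 - n\<close> and \<open>i = n - 1\<close> respectively.\<close>
  consider "n = 0" | "n \<ge> 1" | "n \<le> - 1" by linarith
  then show ?thesis
  proof cases
    case 1
    then have "f = (\<lambda>_. 0)"
      by (auto simp: f_def fun_eq_iff Y_vac Y_zero)
    with 1 * show ?thesis by simp
  next
    case 2
    then have f: "f i = (if i = nat (n - 1) then - (of_int n *\<^sub>C Y v (n - 1) w) else 0)" for i
      by (auto simp: f_def Y_vac Y_zero)
    then have "Sum_any f = (\<Sum>i\<in>{nat (n - 1)}. f i)"
      by (intro Sum_any.expand_superset) auto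
    with f * show ?thesis by simp
  next
    case 3
    then have f: "f i = (if i = nat (- 1 - n) then - (of_int n *\<^sub>C Y v (n - 1) w) else 0)" for i
      by (auto simp: f_def Y_vac Y_zero)
    then have "Sum_any f = (\<Sum>i\<in>{nat (- 1 - n)}. f i)"
      by (intro Sum_any.expand_superset) auto
    with f * show ?thesis by simp
  qed
qed

lemma translation_derivation:
  "Y (Y u n v) (- 2) vac = Y u n (Y v (- 2) vac) - of_int n *\<^sub>C Y u (n - 1) v"
  unfolding iterate_formula[of u n v "- 2" vac]
  by (subst Sum_any_expand[where N = 2])
    (auto simp: creation Y_zero lessThan_nat_numeral lessThan_Suc scaleC_one)

end

section \<open>Eigenvectors of a graded operator\<close>

lemma eigenvectors_independent:
  fixes T :: "'v::complex_vector \<Rightarrow> 'v" and g :: "nat \<Rightarrow> 'v"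
  assumes T: "clinear T" and "finite K" and "\<And>k. k \<in> K \<Longrightarrow> T (g k) = of_nat k *\<^sub>C g k"
    and "(\<Sum>k\<in>K. g k) = 0" and "k \<in> K"
  shows "g k = 0"
  using assms(2-5)
proof (induction K arbitrary: g k)
  case (insert a K)
  \<comment> \<open>Applying \<open>T - a\<close> removes the summand with index \<open>a\<close>.\<close>
  have "(\<Sum>k\<in>K. (of_nat k - of_nat a) *\<^sub>C g k) = (\<Sum>k\<in>insert a K. (of_nat k - of_nat a) *\<^sub>C g k)"
    using insert(1,2) by simp
  also have "\<dots> = (\<Sum>k\<in>insert a K. T (g k)) - of_nat a *\<^sub>C (\<Sum>k\<in>insert a K. g k)"
    using insert(4) by (simp add: complex_vector.scale_left_diff_distrib sum_subtractf
        complex_vector.scale_sum_right del: sum.insert)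
  also have "\<dots> = 0"
    using insert(5) by (simp add: clinear_simps(3)[OF T] flip: clinear_simps(6)[OF T] del: sum.insert)
  finally have *: "(\<Sum>k\<in>K. (of_nat k - of_nat a) *\<^sub>C g k) = 0" .
  have 0: "g k = 0" if "k \<in> K" for k
  proof -
    have "(of_nat k - of_nat a) *\<^sub>C g k = 0"
      by (rule insert.IH[OF _ * that])
        (use insert(4) in \<open>simp add: clinear_simps[OF T] scaleC_scaleC mult.commute\<close>)
    moreover have "of_nat k - of_nat a \<noteq> (0 :: complex)"
      using that insert(2) by auto
    ultimately show ?thesis by simp
  qed
  moreover have "g a = 0" using insert(1,2,5) 0 by simp
  ultimately show ?case using insert(6) by auto
qed simp

text \<open>
  An eigenvector has only one nonzero component, because the components of distinct degrees are
  eigenvectors for distinct eigenvalues.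
\<close>
lemma eigenvector_cases:
  fixes T :: "'v::complex_vector \<Rightarrow> 'v" and E :: "nat \<Rightarrow> 'v set"
  assumes T: "clinear T" and E: "\<And>k v. v \<in> E k \<Longrightarrow> T v = of_nat k *\<^sub>C v"
    and sub: "\<And>k. complex_vector.subspace (E k)"
    and span: "complex_vector.span (\<Union>k. E k) = UNIV"
    and v: "T v = of_int m *\<^sub>C v"
  shows "v = 0 \<or> m \<ge> 0 \<and> v \<in> E (nat m)"
proof -
  have "\<exists>K f. finite K \<and> (\<forall>k. f k \<in> E k) \<and> x = (\<Sum>k\<in>K. f k)" for x
  proof -
    have "x \<in> complex_vector.span (\<Union>k. E k)" by (simp add: span)
    then show ?thesis
    proof (induction rule: complex_vector.span_induct_alt)
      case base
      then show ?case
        by (intro exI[of _ "{}"] exI[of _ "\<lambda>_. 0"]) (simp add: complex_vector.subspace_0[OF sub])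
    next
      case (step c y z)
      then obtain l K f where y: "y \<in> E l" and f: "finite K" "\<And>k. f k \<in> E k" "z = (\<Sum>k\<in>K. f k)"
        by blast
      define f' where "f' k = (if k \<in> K then f k else 0) + (if k = l then c *\<^sub>C y else 0)" for k
      have "f' k \<in> E k" for k
        using y f(2) by (auto simp: f'_def intro!: complex_vector.subspace_add[OF sub]
            complex_vector.subspace_scale[OF sub] complex_vector.subspace_0[OF sub])
      moreover have "c *\<^sub>C y + z = (\<Sum>k\<in>insert l K. f' k)"
        using f(1,3) by (simp add: f'_def sum.distrib sum.If_cases Int_absorb1 subset_insertI
            insert_absorb add.commute)
      ultimately show ?case using f(1) by (intro exI[of _ "insert l K"] exI[of _ f']) simp
    qed
  qed
  then obtain K f where f: "finite K" "\<And>k. f k \<in> E k" "v = (\<Sum>k\<in>K. f k)"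
    by metis
  \<comment> \<open>The components of \<open>T v - m v = 0\<close>.\<close>
  define g where "g k = (of_nat k - of_int m) *\<^sub>C f k" for k
  have "(\<Sum>k\<in>K. g k) = T v - of_int m *\<^sub>C v"
    by (simp add: g_def f(3) clinear_simps[OF T] E[OF f(2)] complex_vector.scale_left_diff_distrib
        sum_subtractf complex_vector.scale_sum_right)
  then have "(\<Sum>k\<in>K. g k) = 0" by (simp add: v)
  moreover have "T (g k) = of_nat k *\<^sub>C g k" for k
    by (simp add: g_def clinear_simps[OF T] E[OF f(2)] scaleC_scaleC mult.commute)
  ultimately have g0: "g k = 0" if "k \<in> K" for k
    using eigenvectors_independent[OF T f(1), of g k] that by blast
  have f0: "f k = 0" if "k \<in> K" "int k \<noteq> m" for k
  proof -
    have "of_nat k - of_int m \<noteq> (0 :: complex)"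
      using that(2) by (metis eq_iff_diff_eq_0 of_int_eq_iff of_int_of_nat_eq)
    with g0[OF that(1)] show ?thesis by (simp add: g_def)
  qed
  show ?thesis
  proof (cases "m \<ge> 0 \<and> nat m \<in> K")
    case True
    have "f k = 0" if "k \<in> K - {nat m}" for k
      using f0[of k] that by auto
    then have "sum f (K - {nat m}) = 0" by (intro sum.neutral) blast
    with True f(1) have "v = f (nat m)"
      by (simp add: f(3) sum.remove[of K "nat m"])
    with True f(2) show ?thesis by auto
  next
    case False
    then have "f k = 0" if "k \<in> K" for k
      using f0[of k] that by (cases "int k = m") auto
    then have "v = 0" unfolding f(3) by (intro sum.neutral) blast
    then show ?thesis by simp
  qed
qed

section \<open>The conformal vectors of the Heisenberg vertex algebra\<close>

locale heisenberg_va = vertex_algebra Y vacuum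
  for Y :: "'h::quadratic_space heis_vac \<Rightarrow> int \<Rightarrow> 'h heis_vac \<Rightarrow> 'h heis_vac" +
  fixes B :: "'h set"
  assumes Y_mode: "Y (mode u (- 1) vacuum) n = mode u n"
    and B: "orthonormal_basis B"
begin

lemma mode_commutator_formula:
  "mode u m (Y v n w) - Y v n (mode u m w)
    = Sum_any (\<lambda>i. (of_int m gchoose i) *\<^sub>C Y (mode u (int i) v) (m + n - int i) w)"
  using commutator_formula[of "mode u (- 1) vacuum"] by (simp add: Y_mode)

text \<open>
  Of the vectors \<open>u(i)\<omega>\<^sub>h\<close> with \<open>i \<ge> 0\<close> only \<open>u(1)\<omega>\<^sub>h = u(-1)\<one>\<close> and \<open>u(2)\<omega>\<^sub>h = 2\<langle>u,h\<rangle>\<one>\<close> are nonzero, so the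
  commutator formula has two terms; the second contributes a scalar, as \<open>\<one>\<close> has a single mode.
\<close>
lemma omega_mode:
  "Y (omega B h) n (mode u m w) = mode u m (Y (omega B h) n w) - of_int m *\<^sub>C mode u (m + n - 1) w
     - (if m + n = 1 then of_int (m * (m - 1)) * form u h else 0) *\<^sub>C w"
proof -
  have two: "a gchoose 2 = a * (a - 1) / 2" for a :: complex
    by (simp add: gbinomial_prod_rev numeral_2_eq_2)
  have "mode u m (Y (omega B h) n w) - Y (omega B h) n (mode u m w) =
      of_int m *\<^sub>C mode u (m + n - 1) w + (if m + n = 1 then of_int (m * (m - 1)) * form u h else 0) *\<^sub>C w"
    unfolding mode_commutator_formula
    by (subst Sum_any_expand[where N = 3])
      (auto simp: mode_omega[OF B] Y_zero numeral_3_eq_3 lessThan_Suc two[unfolded numeral_2_eq_2] Y_mode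
        clinear_simps(2)[OF Y_linear_left] Y_vac scaleC_scaleC)
  then show ?thesis by (simp add: algebra_simps)
qed

lemma omega_vacuum: "n \<ge> 0 \<Longrightarrow> Y (omega B h) n vacuum = 0"
  by (rule creation)

lemma L0_standard_grade:
  assumes "v \<in> standard_grade n"
  shows "Y (omega B h) 1 v = of_nat n *\<^sub>C v"
  using assms unfolding standard_grade_altdef
proof (induction rule: complex_vector.span_induct_alt)
  case base
  then show ?case by (simp add: Y_zero)
next
  case (step c x y)
  have "Y (omega B h) 1 (fock_monomial uks) = of_nat (sum_list (map snd uks)) *\<^sub>C fock_monomial uks"
    if "creation_word uks" for uks
    using that
  proof (induction uks)
    case Nil
    then show ?case by (simp add: fock_monomial_simps omega_vacuum)
  next
    case (Cons uk uks)
    then show ?case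
      by (cases uk) (simp add: fock_monomial_simps creation_word_simps omega_mode
          clinear_simps[OF mode_clinear] scaleC_add_left)
  qed
  with step show ?case
    by (auto simp: clinear_simps[OF Y_linear_right] scaleC_add_right complex_vector.scale_left_commute)
qed

lemma L0_eigenvector:
  assumes "\<And>n v. v \<in> standard_grade n \<Longrightarrow> Y \<omega> 1 v = of_nat n *\<^sub>C v"
    and "Y \<omega> 1 v = of_int m *\<^sub>C v"
  shows "v = 0 \<or> m \<ge> 0 \<and> v \<in> standard_grade (nat m)"
  using eigenvector_cases[OF Y_linear_right assms(1) subspace_standard_grade standard_grades_span assms(2)] .

text \<open>
  Both operators annihilate \<open>\<one>\<close> and have commutator \<open>-n u(n-1)\<close> with \<open>u(n)\<close>.  The scalar term of
  the commutator with \<open>L(-1)\<close> has the factor \<open>n(n-1)\<close> and occurs only for \<open>n = 1\<close>, where it vanishes.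
\<close>
lemma L_minus_1_eq_translation: "Y (omega B h) 0 v = Y v (- 2) vacuum"
proof (induction v rule: mode_induct)
  case (4 u n v)
  have "Y (mode u n v) (- 2) vacuum = mode u n (Y v (- 2) vacuum) - of_int n *\<^sub>C mode u (n - 1) v"
    using translation_derivation[of "mode u (- 1) vacuum" n v] by (simp add: Y_mode)
  with 4 show ?case by (auto simp: omega_mode)
qed (simp_all add: omega_vacuum Y_vac clinear_simps[OF Y_linear_right] clinear_simps[OF Y_linear_left])

text \<open>
  In degree one the contributions of the quadratic part and of \<open>h(-2)\<one>\<close> to \<open>L(1)\<omega>\<^sub>h\<close> cancel; in degree
  zero they add up to half the central charge times \<open>\<one>\<close>.
\<close>
lemma omega_omega:
  assumes "i \<ge> 2"
  shows "Y (omega B h) i (omega B h)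
    = (if i = 3 then of_nat (card B) / 2 - 6 * form h h else 0) *\<^sub>C vacuum"
proof -
  have four: "(4 * c) *\<^sub>C v = (2 * c) *\<^sub>C v + (2 * c) *\<^sub>C v" for c and v :: "'h heis_vac"
    by (simp flip: scaleC_add_left)
  have 1: "Y (omega B h) i (mode b (- 1) (mode b (- 1) vacuum)) =
      (if i = 3 then 1 else 0) *\<^sub>C vacuum - (if i = 2 then 4 * form b h else 0) *\<^sub>C mode b (- 1) vacuum"
    if "b \<in> B" for b
    using assms that B
    by (auto simp: omega_mode omega_vacuum clinear_simps[OF mode_clinear] mode_vacuum mode_zero
        mode_commute[of b "i - 2"] mode_commute[of b 1] orthonormal_basis_def scaleC_one
        four)
  have 2: "Y (omega B h) i (mode h (- 2) vacuum) =
      (if i = 2 then 2 else 0) *\<^sub>C mode h (- 1) vacuum - (if i = 3 then 6 * form h h else 0) *\<^sub>C vacuum"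
    using assms by (auto simp: omega_mode omega_vacuum clinear_simps[OF mode_clinear] mode_vacuum)
  have "(\<Sum>b\<in>B. form b h *\<^sub>C mode b (- 1) vacuum) = mode h (- 1) vacuum"
    using orthonormal_basis_expansion[OF B, of h]
    by (simp add: form_commute[of _ h] flip: clinear_simps(2,6)[OF mode_clinear_left])
  then have 3: "(\<Sum>b\<in>B. (4 * form b h) *\<^sub>C mode b (- 1) vacuum) = 4 *\<^sub>C mode h (- 1) vacuum"
    by (simp flip: scaleC_scaleC complex_vector.scale_sum_right)
  have "Y (omega B h) i (omega B h) =
    (1 / 2) *\<^sub>C (\<Sum>b\<in>B. Y (omega B h) i (mode b (- 1) (mode b (- 1) vacuum)))
      + Y (omega B h) i (mode h (- 2) vacuum)"
    unfolding omega_def[of B h, THEN arg_cong, of "Y (omega B h) i"]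
    by (simp only: clinear_simps[OF Y_linear_right])
  also have "\<dots> = (if i = 3 then of_nat (card B) / 2 - 6 * form h h else 0) *\<^sub>C vacuum"
    unfolding 2 using assms
    by (auto simp: 1 sum_subtractf complex_vector.scale_right_diff_distrib scaleC_scaleC
        complex_vector.sum_constant_scale complex_vector.scale_left_diff_distrib sum_negf
        3 simp flip: complex_vector.scale_sum_right)
  finally show ?thesis .
qed

text \<open>
  The commutator formula applied to \<open>\<omega>\<^sub>h\<close> and itself: the terms come from \<open>L(-1)\<omega>\<^sub>h\<close>, which is a
  derivative, from \<open>L(0)\<omega>\<^sub>h = 2\<omega>\<^sub>h\<close>, and from \<open>L(2)\<omega>\<^sub>h\<close>, which is a multiple of \<open>\<one>\<close>.
\<close>
lemma virasoro_omega:
  fixes m n :: int and h w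
  defines "\<omega> \<equiv> omega B h"
  shows "Y \<omega> (m + 1) (Y \<omega> (n + 1) w) - Y \<omega> (n + 1) (Y \<omega> (m + 1) w)
    = of_int (m - n) *\<^sub>C Y \<omega> (m + n + 1) w
      + (if m + n = 0 then of_int (m ^ 3 - m) / 12 * (of_nat (card B) - 12 * form h h) else 0) *\<^sub>C w"
proof -
  have three: "(a + 1) gchoose 3 = (a ^ 3 - a) / 6" for a :: complex
    by (simp add: gbinomial_prod_rev numeral_3_eq_3 algebra_simps)
  have L1: "Y \<omega> 1 \<omega> = 2 *\<^sub>C \<omega>"
    using L0_standard_grade[OF omega_in_standard_grade_2] by (simp add: \<omega>_def)
  have L0: "Y (Y \<omega> 0 \<omega>) k w = - (of_int k *\<^sub>C Y \<omega> (k - 1) w)" for k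
    by (simp add: \<omega>_def L_minus_1_eq_translation translation_derivative)
  let ?f = "\<lambda>i. (of_int (m + 1) gchoose i) *\<^sub>C Y (Y \<omega> (int i) \<omega>) (m + 1 + (n + 1) - int i) w"
  have "Y \<omega> (m + 1) (Y \<omega> (n + 1) w) - Y \<omega> (n + 1) (Y \<omega> (m + 1) w) = (\<Sum>i<4. ?f i)"
    unfolding commutator_formula
    by (rule Sum_any_expand) (simp add: omega_omega Y_zero \<omega>_def)
  also have "\<dots> = ?f 0 + ?f 1 + ?f 2 + ?f 3"
    by (simp add: eval_nat_numeral)
  also have "?f 0 = - (of_int (m + n + 2) *\<^sub>C Y \<omega> (m + n + 1) w)"
    by (simp add: L0 scaleC_one algebra_simps)
  also have "?f 1 = (of_int (m + 1) * 2) *\<^sub>C Y \<omega> (m + n + 1) w"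
    by (simp add: L1 clinear_simps(2)[OF Y_linear_left] scaleC_scaleC algebra_simps)
  also have "?f 2 = 0"
    by (simp add: \<omega>_def omega_omega Y_zero)
  also have "?f 3 = (if m + n = 0 then of_int (m ^ 3 - m) / 12 * (of_nat (card B) - 12 * form h h) else 0) *\<^sub>C w"
  proof -
    define K where "K = of_nat (card B) / 2 - 6 * form h h"
    have "Y \<omega> 3 \<omega> = K *\<^sub>C vacuum"
      by (simp add: \<omega>_def omega_omega K_def)
    moreover have "of_int (m + 1) gchoose 3 = (of_int (m ^ 3 - m) / 6 :: complex)"
      using three[of "of_int m"] by simp
    ultimately have "?f 3 = (of_int (m ^ 3 - m) / 6 * (if m + n = 0 then K else 0)) *\<^sub>C w"
      by (simp add: clinear_simps(2)[OF Y_linear_left] Y_vac scaleC_scaleC)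
    also have "of_int (m ^ 3 - m) / 6 * (if m + n = 0 then K else 0) =
        (if m + n = 0 then of_int (m ^ 3 - m) / 12 * (of_nat (card B) - 12 * form h h) else 0)"
      by (simp add: K_def field_simps)
    finally show ?thesis .
  qed
  also have "- (of_int (m + n + 2) *\<^sub>C Y \<omega> (m + n + 1) w) + (of_int (m + 1) * 2) *\<^sub>C Y \<omega> (m + n + 1) w
      = of_int (m - n) *\<^sub>C Y \<omega> (m + n + 1) w"
    by (simp add: algebra_simps flip: complex_vector.scale_left_diff_distrib complex_vector.scale_minus_left scaleC_add_left)
  finally show ?thesis by simp
qed

lemma omega_graded_conformal: "omega B h \<in> graded_conformal_structures Y"
proof -
  have eigen: "v = 0 \<or> m \<ge> 0 \<and> v \<in> standard_grade (nat m)" if "Y (omega B h) 1 v = of_int m *\<^sub>C v" for v m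
    using L0_eigenvector[OF L0_standard_grade that] .
  have "vertex_operator_algebra Y vacuum (omega B h)"
  proof (intro vertex_operator_algebra.intro vertex_algebra_axioms vertex_operator_algebra_axioms.intro)
    show "\<exists>c. \<forall>m n v. Y (omega B h) (m + 1) (Y (omega B h) (n + 1) v)
        - Y (omega B h) (n + 1) (Y (omega B h) (m + 1) v)
      = of_int (m - n) *\<^sub>C Y (omega B h) (m + n + 1) v
        + (if m + n = 0 then of_int (m ^ 3 - m) / 12 * c else 0) *\<^sub>C v"
      using virasoro_omega by blast
    show "Y (Y (omega B h) 0 v) n w = - (of_int n *\<^sub>C Y v (n - 1) w)" for v n w
      by (simp add: L_minus_1_eq_translation translation_derivative)
    have "(\<Union>n. standard_grade n) \<subseteq> (\<Union>n::int. {v. Y (omega B h) 1 v = of_int n *\<^sub>C v})"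
      using L0_standard_grade by (auto intro!: exI[of _ "int _"])
    from complex_vector.span_mono[OF this]
    show "complex_vector.span (\<Union>n::int. {v. Y (omega B h) 1 v = of_int n *\<^sub>C v}) = UNIV"
      by (simp add: standard_grades_span top.extremum_unique)
    show "\<exists>A. finite A \<and> {v. Y (omega B h) 1 v = of_int n *\<^sub>C v} \<subseteq> complex_vector.span A" for n
    proof -
      obtain A :: "'h heis_vac set" where "finite A" "standard_grade (nat n) \<subseteq> complex_vector.span A"
        using finite_dim_standard_grade[OF B] by blast
      then show ?thesis
        using eigen complex_vector.span_zero by (intro exI[of _ A]) blast
    qed
    show "\<exists>N::int. \<forall>n<N. {v. Y (omega B h) 1 v = of_int n *\<^sub>C v} = {0}"
    proof (intro exI[of _ 0] allI impI)
      fix n :: int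
      assume "n < 0"
      then show "{v. Y (omega B h) 1 v = of_int n *\<^sub>C v} = {0}"
        using eigen by (fastforce simp: Y_zero)
    qed
  qed
  then show ?thesis
    by (simp add: graded_conformal_structures_def L0_standard_grade)
qed

text \<open>
  A vector \<open>\<omega>\<close> as assumed has degree two by the Virasoro relation between \<open>L(0)\<close> and \<open>L(-2)\<close>, as
  \<open>\<omega> = L(-2)\<one>\<close>.  By the criterion above it is enough to show \<open>u(1)\<omega> = u(-1)\<one>\<close>.  This vector has degree
  one, so it is \<open>x(-1)\<one>\<close> for some \<open>x\<close>, and computing \<open>[u(1), L(0)]\<close> in two ways gives \<open>x(1) = u(1)\<close>.
\<close>
lemma graded_conformal_omega:
  assumes "\<omega> \<in> graded_conformal_structures Y"
  obtains h where "\<omega> = omega B h"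
proof -
  interpret V: vertex_operator_algebra Y vacuum \<omega>
    using assms by (simp add: graded_conformal_structures_def)
  have grade: "Y \<omega> 1 v = of_nat n *\<^sub>C v" if "v \<in> standard_grade n" for n v
    using assms that by (simp add: graded_conformal_structures_def)
  note eigen = L0_eigenvector[OF grade]
  have L0: "Y \<omega> 1 \<omega> = 2 *\<^sub>C \<omega>"
  proof -
    obtain c where "\<forall>m n v. Y \<omega> (m + 1) (Y \<omega> (n + 1) v) - Y \<omega> (n + 1) (Y \<omega> (m + 1) v)
        = of_int (m - n) *\<^sub>C Y \<omega> (m + n + 1) v
          + (if m + n = 0 then of_int (m ^ 3 - m) / 12 * c else 0) *\<^sub>C v"
      using V.virasoro by blast
    from this[rule_format, of 0 "- 2" vacuum] show ?thesis
      by (simp add: creation Y_zero)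
  qed
  have grade2: "\<omega> \<in> standard_grade 2"
    using eigen[of \<omega> 2] L0 complex_vector.subspace_0[OF subspace_standard_grade] by auto
  have "mode u 1 \<omega> = mode u (- 1) vacuum" for u
  proof -
    let ?a = "mode u (- 1) vacuum"
    have one: "(1 gchoose i :: complex) = 0" if "i \<ge> 2" for i
    proof -
      have "1 choose i = 0" using that by (intro binomial_eq_0) simp
      then have "(of_nat (1 choose i) :: complex) = 0" by (simp only: of_nat_0)
      then show ?thesis by (simp only: binomial_gbinomial of_nat_1)
    qed
    have two: "2 *\<^sub>C v = v + v" for v :: "'h heis_vac"
      using scaleC_add_left[of 1 1 v] by (simp add: scaleC_one)
    have a: "?a \<in> standard_grade 1" unfolding standard_grade_1 by (rule rangeI)
    \<comment> \<open>First computation: \<open>L(0)\<close> is the degree and \<open>u(-1)\<one>\<close> has degree one.\<close>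
    have comm: "Y \<omega> 1 (mode u 1 w) - mode u 1 (Y \<omega> 1 w) = - mode u 1 w" for w
    proof -
      have "Y \<omega> 1 (Y ?a 1 w) - Y ?a 1 (Y \<omega> 1 w)
          = (\<Sum>i<2. (of_int 1 gchoose i) *\<^sub>C Y (Y \<omega> (int i) ?a) (1 + 1 - int i) w)"
        unfolding commutator_formula by (rule Sum_any_expand) (simp add: one)
      also have "\<dots> = Y (Y \<omega> 0 ?a) 2 w + Y (Y \<omega> 1 ?a) 1 w"
        by (simp add: eval_nat_numeral scaleC_one)
      also have "\<dots> = - (2 *\<^sub>C mode u 1 w) + mode u 1 w"
        by (simp add: V.L_minus_1_derivative grade[OF a] Y_mode scaleC_one)
      also have "\<dots> = - mode u 1 w"
        by (simp add: two)
      finally show ?thesis by (simp add: Y_mode)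
    qed
    have "Y \<omega> 1 (mode u 1 \<omega>) = of_int 1 *\<^sub>C mode u 1 \<omega>"
      using comm[of \<omega>] by (simp add: L0 clinear_simps[OF mode_clinear] scaleC_one two)
    then have "mode u 1 \<omega> \<in> standard_grade 1"
      using eigen[of "mode u 1 \<omega>" 1] complex_vector.subspace_0[OF subspace_standard_grade] by auto
    then obtain x where x: "mode u 1 \<omega> = mode x (- 1) vacuum"
      unfolding standard_grade_1 by blast
    \<comment> \<open>Second computation: the commutator formula with the two factors exchanged, where \<open>u(0) = 0\<close>.\<close>
    have "mode u 1 (Y \<omega> 1 w) - Y \<omega> 1 (mode u 1 w)
        = (\<Sum>i<2. (of_int 1 gchoose i) *\<^sub>C Y (mode u (int i) \<omega>) (1 + 1 - int i) w)" for w
      unfolding mode_commutator_formula by (rule Sum_any_expand) (simp add: one)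
    then have "mode u 1 (Y \<omega> 1 w) - Y \<omega> 1 (mode u 1 w) = mode x 1 w" for w
      by (simp add: eval_nat_numeral scaleC_one mode_zero Y_zero x[simplified] Y_mode)
    with comm have "mode u 1 w = mode x 1 w" for w
      by (metis minus_diff_eq add.inverse_inverse)
    then have "form u y *\<^sub>C (vacuum :: 'h heis_vac) = form x y *\<^sub>C vacuum" for y
      using mode_commute[of u 1 y "- 1" vacuum] mode_commute[of x 1 y "- 1" vacuum]
      by (simp add: mode_vacuum clinear_simps[OF mode_clinear] del: complex_vector.scale_cancel_right)
    then have "form (u - x) y = 0" for y
      using vacuum_nonzero[OF B] by (simp add: form_diff_left)
    then have "u - x = 0" by (rule form_nondegenerate)
    with x show ?thesis by simp
  qed
  from omega_eqI[OF B grade2 this] that show thesis by blast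
qed

end

section \<open>Isomorphisms and the orthogonal group\<close>

lemma orthogonal_group_inv:
  assumes "g \<in> orthogonal_group"
  shows "inv g \<in> orthogonal_group"
proof -
  have g: "clinear g" "bij g" "\<And>x y. form (g x) (g y) = form x y"
    using assms by (auto simp: orthogonal_group_def)
  have [simp]: "g (inv g x) = x" "inv g (g x) = x" for x
    using g(2) by (simp_all add: bij_is_surj surj_f_inv_f bij_is_inj)
  have "clinear (inv g)"
  proof (rule clinearI)
    show "inv g (x + y) = inv g x + inv g y" for x y
      by (metis \<open>\<And>x. g (inv g x) = x\<close> \<open>\<And>x. inv g (g x) = x\<close> clinear_simps(1)[OF g(1)])
    show "inv g (c *\<^sub>C x) = c *\<^sub>C inv g x" for c x
      by (metis \<open>\<And>x. g (inv g x) = x\<close> \<open>\<And>x. inv g (g x) = x\<close> clinear_simps(2)[OF g(1)])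
  qed
  moreover have "form (inv g x) (inv g y) = form x y" for x y
    using g(3)[of "inv g x" "inv g y"] by simp
  ultimately show ?thesis
    using g(2) by (simp add: orthogonal_group_def bij_imp_bij_inv)
qed

lemma orthogonal_group_comp:
  assumes "f \<in> orthogonal_group" "g \<in> orthogonal_group"
  shows "f \<circ> g \<in> orthogonal_group"
  using assms by (auto simp: orthogonal_group_def clinear_simps bij_comp intro!: clinearI)

lemma equiv_orbit_rel: "equiv UNIV (orbit_rel :: ('h::quadratic_space \<times> 'h) set)"
proof (rule equivI)
  have "id \<in> orthogonal_group" by (auto simp: orthogonal_group_def intro: clinearI)
  then show "refl (orbit_rel :: ('h \<times> 'h) set)"
    by (auto simp: orbit_rel_def refl_on_def intro!: bexI[of _ id])
  show "sym (orbit_rel :: ('h \<times> 'h) set)"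
  proof (rule symI, clarsimp simp: orbit_rel_def)
    fix x and g :: "'h \<Rightarrow> 'h"
    assume "g \<in> orthogonal_group"
    moreover from this have "inv g (g x) = x"
      by (simp add: orthogonal_group_def bij_is_inj)
    ultimately show "\<exists>g'\<in>orthogonal_group. x = g' (g x)"
      using orthogonal_group_inv by metis
  qed
  show "trans (orbit_rel :: ('h \<times> 'h) set)"
  proof (rule transI)
    fix x y z :: 'h
    assume "(x, y) \<in> orbit_rel" "(y, z) \<in> orbit_rel"
    then obtain f g where "f \<in> orthogonal_group" "g \<in> orthogonal_group" "z = (f \<circ> g) x"
      by (auto simp: orbit_rel_def)
    then show "(x, z) \<in> orbit_rel"
      unfolding orbit_rel_def using orthogonal_group_comp by blast
  qed
qed simp_all

definition heis_map :: "('h::quadratic_space \<Rightarrow> 'h) \<Rightarrow> 'h heis \<Rightarrow> 'h heis"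
  where "heis_map g x = Heis (Poly_Mapping.map g (loop_part x)) (central_part x)"

lemma heis_map_rep:
  assumes "clinear g"
  shows "loop_coeff (heis_map g x) n = g (loop_coeff x n)" "central_part (heis_map g x) = central_part x"
  by (simp_all add: heis_map_def Poly_Mapping.map.rep_eq when_def clinear_simps(3)[OF assms])

lemma heis_eqI:
  assumes "\<And>n. loop_coeff x n = loop_coeff y n" "central_part x = central_part y"
  shows "x = y"
  using assms by (intro heis.expand conjI poly_mapping_eqI)

text \<open>
  The twist by the Lie algebra automorphism induced by \<open>g\<close>.  A bracket is central, hence fixed by that
  automorphism, and orthogonality of \<open>g\<close> makes the cocycle invariant.
\<close>
lemma lie_representation_heis_map:
  assumes g: "g \<in> orthogonal_group"
  shows "lie_representation (\<lambda>x. heis_act (heis_map g x))"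
proof (rule lie_representation.intro)
  have lin: "clinear g" and form: "form (g u) (g v) = form u v" for u v
    using g by (auto simp: orthogonal_group_def)
  fix x y :: "'a heis" and c v
  show "clinear (heis_act (heis_map g x))" by (rule heis_act_clinear)
  have "heis_map g (x + y) = heis_map g x + heis_map g y"
    by (rule heis_eqI) (simp_all add: heis_map_rep[OF lin] plus_heis_def lookup_add clinear_simps[OF lin])
  then show "heis_act (heis_map g (x + y)) v = heis_act (heis_map g x) v + heis_act (heis_map g y) v"
    by (simp add: heis_act_simps)
  have "heis_map g (c *\<^sub>C x) = c *\<^sub>C heis_map g x"
    by (rule heis_eqI) (simp_all add: heis_map_rep[OF lin] scaleC_heis_def scaleC_poly_mapping.rep_eq
        clinear_simps[OF lin])
  then show "heis_act (heis_map g (c *\<^sub>C x)) v = c *\<^sub>C heis_act (heis_map g x) v"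
    by (simp add: heis_act_simps)
  have "heis_map g (bracket x y) = bracket x y"
    by (rule heis_eqI) (simp_all add: heis_map_rep[OF lin] bracket_heis_def clinear_simps[OF lin])
  moreover have "loop_support (heis_map g x) \<subseteq> loop_support x"
    by (auto simp: in_keys_iff heis_map_rep[OF lin] clinear_simps[OF lin])
  then have "bracket (heis_map g x) (heis_map g y) = bracket x y"
    by (subst bracket_heis_superset) (auto simp: heis_map_rep[OF lin] form bracket_heis_def)
  ultimately show "heis_act (heis_map g (bracket x y)) v = heis_act (heis_map g x) (heis_act (heis_map g y) v)
      - heis_act (heis_map g y) (heis_act (heis_map g x) v)"
    by (simp add: heis_act_simps(3)[of "heis_map g x"])
qed

lemma orthogonal_map_extends:
  fixes g :: "'h::quadratic_space \<Rightarrow> 'h"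
  assumes g: "g \<in> orthogonal_group"
  obtains \<phi> :: "'h heis_vac \<Rightarrow> 'h heis_vac" where "clinear \<phi>" "\<phi> vacuum = vacuum"
    "\<And>u n v. \<phi> (mode u n v) = mode (g u) n (\<phi> v)"
proof -
  have lin: "clinear g" using g by (simp add: orthogonal_group_def)
  have "heis_act (heis_map g x) vacuum = central_part x *\<^sub>C vacuum" if "x \<in> heis_nonneg" for x
    using that by (subst heis_act_vacuum) (auto simp: heis_nonneg_def heis_map_rep[OF lin] clinear_simps[OF lin])
  from heis_vac_universal[OF lie_representation_heis_map[OF g] this]
  obtain \<phi> where \<phi>: "clinear \<phi>" "\<phi> vacuum = vacuum"
    "\<And>x v. \<phi> (heis_act x v) = heis_act (heis_map g x) (\<phi> v)"
    by blast
  have "heis_map g (loop u n) = loop (g u) n" for u n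
    by (rule heis_eqI) (simp_all add: heis_map_rep[OF lin], simp_all add: loop_def lookup_single
        when_def clinear_simps[OF lin])
  with \<phi> show thesis by (intro that[of \<phi>]) (simp_all add: mode_eq_heis_act)
qed

context heisenberg_va
begin

text \<open>
  The map for the inverse of \<open>g\<close> is a two-sided inverse, since the composites commute with all modes and
  fix \<open>\<one>\<close>.  Compatibility with all vertex operators follows from compatibility with the modes by
  induction along the iterate formula.
\<close>
lemma orthogonal_map_iso:
  assumes g: "g \<in> orthogonal_group"
  obtains \<phi> where "vertex_algebra_iso Y vacuum Y vacuum \<phi>" "\<And>u n v. \<phi> (mode u n v) = mode (g u) n (\<phi> v)"
proof -
  obtain \<phi> :: "'h heis_vac \<Rightarrow> 'h heis_vac" where \<phi>: "clinear \<phi>" "\<phi> vacuum = vacuum"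
    "\<And>u n v. \<phi> (mode u n v) = mode (g u) n (\<phi> v)"
    using orthogonal_map_extends[OF g] by blast
  obtain \<phi>' :: "'h heis_vac \<Rightarrow> 'h heis_vac" where \<phi>': "clinear \<phi>'" "\<phi>' vacuum = vacuum"
    "\<And>u n v. \<phi>' (mode u n v) = mode (inv g u) n (\<phi>' v)"
    using orthogonal_map_extends[OF orthogonal_group_inv[OF g]] by blast
  have inv: "g (inv g x) = x" "inv g (g x) = x" for x
    using g by (simp_all add: orthogonal_group_def bij_is_surj surj_f_inv_f bij_is_inj)
  have "\<phi>' (\<phi> v) = v" "\<phi> (\<phi>' v) = v" for v
    by (induction v rule: mode_induct; simp add: \<phi> \<phi>' clinear_simps[OF \<phi>(1)] clinear_simps[OF \<phi>'(1)] inv)+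
  then have bij: "bij \<phi>"
    by (intro o_bij[of \<phi>']) (auto simp: fun_eq_iff)
  \<comment> \<open>An injective linear map keeps the support, so it commutes with the sum over the support.\<close>
  have Sum: "\<phi> (Sum_any f) = Sum_any (\<lambda>i. \<phi> (f i))" for f :: "nat \<Rightarrow> 'h heis_vac"
  proof -
    have "{i. \<phi> (f i) \<noteq> 0} = {i. f i \<noteq> 0}"
      using bij clinear_simps(3)[OF \<phi>(1)] by (metis bij_is_inj inj_eq)
    then show ?thesis
      by (simp add: Sum_any.expand_set clinear_simps[OF \<phi>(1)])
  qed
  have "\<phi> (Y v n w) = Y (\<phi> v) n (\<phi> w)" for v n w
  proof (induction v arbitrary: n w rule: mode_induct)
    case (4 u l v)
    have "\<phi> (Y (Y (mode u (- 1) vacuum) l v) n w) = Y (Y (mode (g u) (- 1) vacuum) l (\<phi> v)) n (\<phi> w)"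
      unfolding iterate_formula[of _ l] Sum
      by (simp add: clinear_simps[OF \<phi>(1)] Y_mode \<phi> 4)
    then show ?case by (simp add: Y_mode \<phi>)
  qed (simp_all add: \<phi> Y_vac clinear_simps[OF \<phi>(1)] clinear_simps[OF Y_linear_left])
  with \<phi> bij show thesis by (intro that[of \<phi>]) (simp_all add: vertex_algebra_iso_def)
qed

text \<open>Compare \<open>u(2)\<omega>\<^sub>h = 2\<langle>u,h\<rangle>\<one>\<close> with its image \<open>(g u)(2)\<omega>\<^bsub>h'\<^esub> = 2\<langle>g u,h'\<rangle>\<one>\<close>.\<close>
lemma iso_omega:
  assumes iso: "vertex_algebra_iso Y vacuum Y vacuum \<phi>" and g: "g \<in> orthogonal_group"
    and \<phi>g: "\<And>u. \<phi> (mode u (- 1) vacuum) = mode (g u) (- 1) vacuum"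
    and \<omega>: "\<phi> (omega B h) = omega B h'"
  shows "h' = g h"
proof -
  have \<phi>: "clinear \<phi>" "\<phi> vacuum = vacuum" "\<And>u n v. \<phi> (Y u n v) = Y (\<phi> u) n (\<phi> v)"
    using iso by (auto simp: vertex_algebra_iso_def)
  have \<phi>_mode: "\<phi> (mode u n v) = mode (g u) n (\<phi> v)" for u n v
    using \<phi>(3)[of "mode u (- 1) vacuum" n v] by (simp add: \<phi>g Y_mode)
  have "form (g u) h' = form (g u) (g h)" for u
  proof -
    have "\<phi> (mode u 2 (omega B h)) = mode (g u) 2 (omega B h')"
      by (simp add: \<phi>_mode \<omega>)
    then have "(2 * form u h) *\<^sub>C (vacuum :: 'h heis_vac) = (2 * form (g u) h') *\<^sub>C vacuum"
      by (simp add: mode_omega[OF B] clinear_simps[OF \<phi>(1)] \<phi>(2))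
    then show ?thesis
      using vacuum_nonzero[OF B] g by (simp add: orthogonal_group_def)
  qed
  moreover have "surj g" using g by (simp add: orthogonal_group_def bij_is_surj)
  ultimately have "form u h' = form u (g h)" for u
    by (metis surjD)
  then have "form (h' - g h) u = 0" for u
    by (metis form_diff_left form_commute right_minus_eq)
  then show ?thesis
    using form_nondegenerate[of "h' - g h"] by simp
qed

text \<open>
  The image of \<open>\<omega>\<^sub>h\<close> involves the orthonormal basis \<open>g B\<close> in place of \<open>B\<close>.  The two are compared through
  modes: the action of \<open>u(1)\<close> shows that the image is some \<open>\<omega>\<^bsub>h'\<^esub>\<close>, and \<open>u(2)\<close> then gives \<open>h' = g h\<close>.
\<close>
lemma orthogonal_imp_isomorphic:
  assumes g: "g \<in> orthogonal_group"
  shows "voa_isomorphic Y vacuum (omega B h) Y vacuum (omega B (g h))"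
proof -
  obtain \<phi> where iso: "vertex_algebra_iso Y vacuum Y vacuum \<phi>"
    and \<phi>_mode: "\<And>u n v. \<phi> (mode u n v) = mode (g u) n (\<phi> v)"
    using orthogonal_map_iso[OF g] by blast
  have \<phi>: "clinear \<phi>" "\<phi> vacuum = vacuum"
    using iso by (auto simp: vertex_algebra_iso_def)
  have "\<phi> (omega B h) = (1 / 2) *\<^sub>C (\<Sum>b\<in>B. mode (g b) (- 1) (mode (g b) (- 1) vacuum)) + mode (g h) (- 2) vacuum"
    by (simp add: omega_def clinear_simps[OF \<phi>(1)] \<phi>_mode \<phi>(2))
  moreover have "mode (g b) (- 1) (mode (g b) (- 1) vacuum) \<in> standard_grade 2" for b
    using fock_monomial_in_standard_grade[of "[(g b, 1), (g b, 1)]"]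
    by (simp add: fock_monomial_simps creation_word_simps numeral_2_eq_2)
  moreover have "mode (g h) (- 2) vacuum \<in> standard_grade 2"
    using fock_monomial_in_standard_grade[of "[(g h, 2)]"]
    by (simp add: fock_monomial_simps creation_word_simps)
  ultimately have "\<phi> (omega B h) \<in> standard_grade 2"
    by (simp only:) (intro complex_vector.subspace_add complex_vector.subspace_scale
        complex_vector.subspace_sum subspace_standard_grade)
  moreover have "mode u 1 (\<phi> (omega B h)) = mode u (- 1) vacuum" for u
  proof -
    obtain u' where "u = g u'"
      using g by (metis (no_types, lifting) bij_is_surj mem_Collect_eq orthogonal_group_def surjD)
    then show ?thesis
      by (simp add: mode_omega[OF B] \<phi>(2) flip: \<phi>_mode) (simp add: \<phi>_mode \<phi>(2))
  qed
  ultimately obtain h' where h': "\<phi> (omega B h) = omega B h'"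
    using omega_eqI[OF B] by metis
  have "h' = g h"
    by (rule iso_omega[OF iso g _ h']) (simp add: \<phi>_mode \<phi>(2))
  with h' iso show ?thesis by (auto simp: voa_isomorphic_def)
qed

text \<open>
  The degree-one space is the space of vectors fixed by \<open>L(0)\<close>, so the isomorphism maps it onto itself;
  \<open>g\<close> is the restriction, transported along the injection \<open>u \<mapsto> u(-1)\<one>\<close>.
\<close>
lemma isomorphic_imp_orthogonal:
  assumes "voa_isomorphic Y vacuum (omega B h) Y vacuum (omega B h')"
  obtains g where "g \<in> orthogonal_group" "h' = g h"
proof -
  obtain \<phi> where iso: "vertex_algebra_iso Y vacuum Y vacuum \<phi>" and \<omega>: "\<phi> (omega B h) = omega B h'"
    using assms by (auto simp: voa_isomorphic_def)
  have \<phi>: "clinear \<phi>" "bij \<phi>" "\<phi> vacuum = vacuum" "\<And>u n v. \<phi> (Y u n v) = Y (\<phi> u) n (\<phi> v)"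
    using iso by (auto simp: vertex_algebra_iso_def)
  have weight_1: "v \<in> range (\<lambda>u. mode u (- 1) vacuum) \<longleftrightarrow> Y (omega B k) 1 v = v" for k v
  proof
    assume "v \<in> range (\<lambda>u. mode u (- 1) vacuum)"
    then show "Y (omega B k) 1 v = v"
      unfolding standard_grade_1[symmetric] by (auto dest: L0_standard_grade simp: scaleC_one)
  next
    assume "Y (omega B k) 1 v = v"
    then have "v = 0 \<or> v \<in> standard_grade (nat 1)"
      using L0_eigenvector[OF L0_standard_grade, where m = 1] by (auto simp: scaleC_one)
    then show "v \<in> range (\<lambda>u. mode u (- 1) vacuum)"
      using complex_vector.subspace_0[OF subspace_standard_grade] unfolding standard_grade_1[symmetric]
      by auto
  qed
  have transport: "Y (omega B h') 1 (\<phi> v) = \<phi> v \<longleftrightarrow> Y (omega B h) 1 v = v" for v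
    using \<phi>(2) by (metis \<omega> \<phi>(4) bij_is_inj inj_eq)
  have "\<exists>u'. \<phi> (mode u (- 1) vacuum) = mode u' (- 1) vacuum" for u
    using weight_1[of "\<phi> (mode u (- 1) vacuum)" h'] weight_1[of "mode u (- 1) vacuum" h] transport
    by blast
  then obtain g where \<phi>g: "\<And>u. \<phi> (mode u (- 1) vacuum) = mode (g u) (- 1) vacuum"
    by metis
  note inject = mode_vacuum_inject[OF B]
  have lin: "clinear g"
    by (intro clinearI inject)
      (simp_all add: clinear_simps[OF mode_clinear_left] clinear_simps[OF \<phi>(1)] flip: \<phi>g)
  have form: "form (g u) (g v) = form u v" for u v
  proof -
    have "\<phi> (mode u 1 (mode v (- 1) vacuum)) = mode (g u) 1 (mode (g v) (- 1) vacuum)"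
      using \<phi>(4)[of "mode u (- 1) vacuum" 1 "mode v (- 1) vacuum"] by (simp add: \<phi>g Y_mode)
    then have "form u v *\<^sub>C (vacuum :: 'h heis_vac) = form (g u) (g v) *\<^sub>C vacuum"
      by (simp add: mode_commute[of _ 1] mode_vacuum clinear_simps[OF mode_clinear]
          clinear_simps[OF \<phi>(1)] \<phi>(3))
    then show ?thesis using vacuum_nonzero[OF B] by simp
  qed
  have "inj g"
    using \<phi>g inject \<phi>(2) by (metis bij_is_inj inj_def)
  moreover have "\<exists>u. w = g u" for w
  proof -
    obtain v where v: "\<phi> v = mode w (- 1) vacuum"
      using \<phi>(2) by (metis bij_is_surj surjD)
    have "v \<in> range (\<lambda>u. mode u (- 1) vacuum)"
      using weight_1 transport[of v] v by (metis rangeI)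
    then obtain u where "v = mode u (- 1) vacuum" by blast
    with v have "mode w (- 1) vacuum = mode (g u) (- 1) vacuum" by (simp add: \<phi>g)
    from inject[OF this] show ?thesis by blast
  qed
  then have "surj g" by (auto simp: surj_def)
  ultimately have "g \<in> orthogonal_group"
    using lin form by (simp add: orthogonal_group_def bij_def)
  moreover from iso_omega[OF iso this \<phi>g \<omega>] have "h' = g h" .
  ultimately show thesis by (rule that)
qed

lemma isomorphic_omega_iff:
  "voa_isomorphic Y vacuum (omega B h) Y vacuum (omega B h') \<longleftrightarrow> (\<exists>g\<in>orthogonal_group. h' = g h)"
  using orthogonal_imp_isomorphic isomorphic_imp_orthogonal by metis

end

section \<open>The moduli space\<close>

text \<open>
  The \<open>s\<close>-class of \<open>f x\<close> is the image of the \<open>r\<close>-class of \<open>x\<close>, so \<open>F\<close> is the map on classes induced by \<open>f\<close>.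
\<close>
lemma bij_betw_quotient:
  assumes "equiv A r" and f: "f ` A = C" and s: "s \<subseteq> C \<times> C"
    and iff: "\<And>x y. x \<in> A \<Longrightarrow> y \<in> A \<Longrightarrow> (f x, f y) \<in> s \<longleftrightarrow> (x, y) \<in> r"
  shows "\<exists>F. bij_betw F (A // r) (C // s) \<and> (\<forall>x\<in>A. F (r `` {x}) = s `` {f x})"
proof -
  define F where "F X = s `` (f ` X)" for X
  have classes: "s `` {f x} = f ` (r `` {x})" if "x \<in> A" for x
  proof (intro equalityI subsetI)
    fix c
    assume "c \<in> s `` {f x}"
    moreover from this obtain y where "y \<in> A" "c = f y" using f s by blast
    ultimately show "c \<in> f ` (r `` {x})" using iff \<open>x \<in> A\<close> by blast
  next
    fix c
    assume "c \<in> f ` (r `` {x})"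
    then obtain y where "(x, y) \<in> r" "c = f y" by blast
    moreover from this have "y \<in> A" using equiv_type[OF assms(1)] by blast
    ultimately show "c \<in> s `` {f x}" using iff \<open>x \<in> A\<close> by blast
  qed
  have F: "F (r `` {x}) = s `` {f x}" if "x \<in> A" for x
  proof -
    have "s `` {f y} = s `` {f x}" if "y \<in> r `` {x}" for y
    proof -
      have "y \<in> A" "r `` {y} = r `` {x}"
        using that equiv_type[OF assms(1)] equiv_class_eq[OF assms(1), of x y] by auto
      then show ?thesis using classes \<open>x \<in> A\<close> by metis
    qed
    moreover have "x \<in> r `` {x}"
      using equiv_class_self[OF assms(1) \<open>x \<in> A\<close>] .
    ultimately show ?thesis unfolding F_def by blast
  qed
  have "bij_betw F (A // r) (C // s)"
  proof (rule bij_betw_imageI)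
    show "F ` (A // r) = C // s"
      using F f by (auto simp: quotient_def image_iff)
    show "inj_on F (A // r)"
    proof (rule inj_onI)
      fix X Z
      assume "X \<in> A // r" "Z \<in> A // r" "F X = F Z"
      then obtain x z where xz: "x \<in> A" "X = r `` {x}" "z \<in> A" "Z = r `` {z}"
        by (auto elim!: quotientE)
      have "(z, z) \<in> r" using equiv_class_self[OF assms(1) xz(3)] by blast
      then have "f z \<in> s `` {f z}" using iff xz(3) by blast
      also have "s `` {f z} = s `` {f x}"
        using \<open>F X = F Z\<close> F xz by simp
      finally have "(x, z) \<in> r" using iff xz(1,3) by blast
      then show "X = Z" using xz equiv_class_eq[OF assms(1)] by auto
    qed
  qed
  with F show ?thesis by blast
qed

theorem corollary1p2:
  fixes Y :: "'h::quadratic_space heis_vac \<Rightarrow> int \<Rightarrow> 'h heis_vac \<Rightarrow> 'h heis_vac"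
    and B :: "'h set"
  assumes "heisenberg_vertex_algebra Y" and "orthonormal_basis B"
  shows "(\<forall>h h'. voa_isomorphic Y vacuum (omega B h) Y vacuum (omega B h')
            \<longleftrightarrow> (\<exists>g\<in>orthogonal_group. h' = g h)) \<and>
         (\<exists>F. bij_betw F (UNIV // (orbit_rel :: ('h \<times> 'h) set))
                (graded_conformal_structures Y // conformal_iso_rel Y) \<and>
              (\<forall>h. F (orbit_rel `` {h}) = conformal_iso_rel Y `` {omega B h}))"
proof -
  interpret vertex_algebra Y vacuum
    using assms(1) by (simp add: heisenberg_vertex_algebra_def)
  interpret heisenberg_va Y B
    by unfold_locales (use assms in \<open>simp_all add: heisenberg_vertex_algebra_def\<close>)
  have "range (omega B) = graded_conformal_structures Y"
    using omega_graded_conformal graded_conformal_omega by blast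
  moreover have "conformal_iso_rel Y \<subseteq> graded_conformal_structures Y \<times> graded_conformal_structures Y"
    by (auto simp: conformal_iso_rel_def)
  moreover have "(omega B h, omega B h') \<in> conformal_iso_rel Y \<longleftrightarrow> (h, h') \<in> orbit_rel" for h h'
    by (simp add: conformal_iso_rel_def orbit_rel_def omega_graded_conformal isomorphic_omega_iff)
  ultimately have "\<exists>F. bij_betw F (UNIV // (orbit_rel :: ('h \<times> 'h) set))
      (graded_conformal_structures Y // conformal_iso_rel Y) \<and>
    (\<forall>h\<in>UNIV. F (orbit_rel `` {h}) = conformal_iso_rel Y `` {omega B h})"
    by (rule bij_betw_quotient[OF equiv_orbit_rel])
  then show ?thesis
    using isomorphic_omega_iff by simp
qed

end
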